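(* Let $B,\Phi\in\mathcal{C}(I,\mathrm{K}_c(\mathbb{R}))$ with $B(t_1)-\Phi(t_1)=B(t_\infty)-\Phi(t_\infty)$, and let $\mathcal{I}=\{I\times\mathrm{K}_c(\mathbb{R});\,G_i:i\in\mathbb{N}\}$ be the countable iterated function system of the maps $G_i:I\times\mathrm{K}_c(\mathbb{R})\to I\times\mathrm{K}_c(\mathbb{R})$, $$G_i(t,S)=\big(\zeta_i(t),\ \alpha S+\Phi(\zeta_i(t))-\alpha B(t)\big),$$ where $\max\{|\alpha|,a_i\}<1$ for each $i\in\mathbb{N}$. Assume that $\boldsymbol{p}=(p_i)_{i\in\mathbb{N}}$ is a probability vector such that $0<p_i<1$ for all $i\in\mathbb{N}$. Then there exists a unique Borel probability measure $\mu_{\boldsymbol{p}}$ on $I\times\mathrm{K}_c(\mathbb{R})$ such that $$\mu_{\boldsymbol{p}}=\sum_{i\in\mathbb{N}}p_i\,\mu_{\boldsymbol{p}}\circ G_i^{-1}.$$ Moreover, $\operatorname{supp}(\mu_{\boldsymbol{p}})=\mathcal{G}(\Phi^{\alpha})$, where $\operatorname{supp}(\mu_{\boldsymbol{p}})$ denotes the support of $\mu_{\boldsymbol{p}}$ and $\mathcal{G}(\Phi^{\alpha})=\{(t,\Phi^{\alpha}(t)):t\in I\}$ is the graph of $\Phi^{\alpha}$.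
   Context: $\mathrm{K}(\mathbb{R})$ is the set of all non-empty compact subsets of $\mathbb{R}$ with the Hausdorff metric $H_d$; $\mathrm{K}_c(\mathbb{R})$ is the subset of non-empty compact convex subsets. $\mathcal{C}(I,\mathrm{K}(\mathbb{R}))$ and $\mathcal{C}(I,\mathrm{K}_c(\mathbb{R}))$ are the sets of continuous maps from $I$. Set operations are Minkowski operations: $C\pm D=\{c\pm d:c\in C,d\in D\}$ and $\alpha C=\{\alpha c:c\in C\}$. A probability vector is a sequence of non-negative reals with sum $1$. Setting: $t_1<t_2<\cdots$ is a strictly increasing real sequence with finite limit $t_\infty$, $I=[t_1,t_\infty]$, $\vartheta=(t_1,t_2,\ldots,t_\infty)$, $I_n=[t_n,t_{n+1}]$ for $n\in J=\mathbb{N}=\{1,2,3,\ldots\}$, and for each $n$, $\zeta_n:I\to I_n$ is a contraction homeomorphism, with contraction coefficient $a_n$ (i.e. $|\zeta_n(t)-\zeta_n(w)|\le a_n|t-w|$), such that either $\zeta_n(t_1)=t_n,\ \zeta_n(t_\infty)=t_{n+1}$ or $\zeta_n(t_1)=t_{n+1},\ \zeta_n(t_\infty)=t_n$. For $\alpha\in\mathbb{R}$ with $|\alpha|<1$, $\Phi^\alpha=\Phi^{\alpha}_{\vartheta,B}$ denotes the continuous function (which the paper asserts to exist and be unique, and in this setting to take values in $\mathrm{K}_c(\mathbb{R})$) satisfying $\Phi^{\alpha}(t)=\Phi(t)+\alpha[\Phi^{\alpha}(\zeta_n^{-1}(t))-B(\zeta_n^{-1}(t))]$ for all $t\in I_n$,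 $n\in J$, and $\Phi^{\alpha}(t_\infty)=\lim_{n\to\infty}\big(\Phi(t_n)+\alpha[\Phi^{\alpha}(\zeta_n^{-1}(t_n))-B(\zeta_n^{-1}(t_n))]\big)$ (limit in $H_d$). The set $I\times\mathrm{K}_c(\mathbb{R})$ carries the metric $D\big((t,S_1),(w,S_2)\big)=|t-w|+H_d\big(S_1+\Phi^{\alpha}(w),S_2+\Phi^{\alpha}(t)\big)$ and the corresponding Borel $\sigma$-algebra.
   Formalization: Existence of the continuous function Φ^α is assumed, not derived from the endpoint condition: for α≠0 it exists only if Φ−B is a constant set (e.g. it fails for B={0}, Φ(t)={(t−t_1)(t_∞−t)}, α=1/2), and otherwise the metric D and the graph are undefined. *)

theory Defs
  imports "HOL-Probability.Probability"
begin

definition KR :: "real set set" where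
  "KR = {S. S \<noteq> {} \<and> compact S}"

definition KcR :: "real set set" where
  "KcR = {S. S \<noteq> {} \<and> compact S \<and> convex S}"

(* Outside KR the distance is set to 0, because the locale Metric_space asks for
   nonnegativity and symmetry on the whole type. *)
definition Hd :: "real set \<Rightarrow> real set \<Rightarrow> real" where
  "Hd A B = (if A \<in> KR \<and> B \<in> KR
             then max (SUP a\<in>A. INF b\<in>B. dist a b) (SUP b\<in>B. INF a\<in>A. dist a b)
             else 0)"

abbreviation KR_top :: "real set topology" where
  "KR_top \<equiv> Metric_space.mtopology KR Hd"

abbreviation KcR_top :: "real set topology" where
  "KcR_top \<equiv> Metric_space.mtopology KcR Hd"

(* The Minkowski sum is the library's + on sets (HOL-Library.Set_Algebras); the library's
   - on sets is set difference, so the Minkowski difference has its own symbol. *)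
definition mink_diff :: "real set \<Rightarrow> real set \<Rightarrow> real set"  (infixl \<open>\<ominus>\<close> 65) where
  "C \<ominus> D = {c - d | c d. c \<in> C \<and> d \<in> D}"

definition mink_scale :: "real \<Rightarrow> real set \<Rightarrow> real set"  (infixr \<open>\<odot>\<close> 75) where
  "\<alpha> \<odot> C = {\<alpha> * c | c. c \<in> C}"

(* Sequences t, \<zeta>, a, p are indexed by 1, 2, 3, ...; their values at index 0 play no role. *)

definition interp_maps ::
  "(nat \<Rightarrow> real) \<Rightarrow> real \<Rightarrow> (nat \<Rightarrow> real \<Rightarrow> real) \<Rightarrow> (nat \<Rightarrow> real) \<Rightarrow> bool" where
  "interp_maps t tinf \<zeta> a \<longleftrightarrow>
     (\<forall>n\<ge>1. homeomorphism {t 1..tinf} {t n..t (Suc n)} (\<zeta> n) (inv_into {t 1..tinf} (\<zeta> n)) \<and>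
            (a n)-lipschitz_on {t 1..tinf} (\<zeta> n) \<and> a n < 1 \<and>
            (\<zeta> n (t 1) = t n \<and> \<zeta> n tinf = t (Suc n) \<or>
             \<zeta> n (t 1) = t (Suc n) \<and> \<zeta> n tinf = t n))"

(* f is the alpha-fractal function of \<Phi> with base function B.  Continuity is asked for in
   K(R) only, not in its subspace of convex sets. *)
definition is_fractal_fun ::
  "(nat \<Rightarrow> real) \<Rightarrow> real \<Rightarrow> (nat \<Rightarrow> real \<Rightarrow> real) \<Rightarrow> real \<Rightarrow>
   (real \<Rightarrow> real set) \<Rightarrow> (real \<Rightarrow> real set) \<Rightarrow> (real \<Rightarrow> real set) \<Rightarrow> bool" where
  "is_fractal_fun t tinf \<zeta> \<alpha> \<Phi> B f \<longleftrightarrow>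
     (let inv\<zeta> = (\<lambda>n. inv_into {t 1..tinf} (\<zeta> n));
          rhs = (\<lambda>n s. \<Phi> s + \<alpha> \<odot> (f (inv\<zeta> n s) \<ominus> B (inv\<zeta> n s)))
      in continuous_map (top_of_set {t 1..tinf}) KR_top f \<and>
         (\<forall>n\<ge>1. \<forall>s\<in>{t n..t (Suc n)}. f s = rhs n s) \<and>
         limitin KR_top (\<lambda>n. rhs n (t n)) (f tinf) sequentially)"

definition ifs_map :: "(nat \<Rightarrow> real \<Rightarrow> real) \<Rightarrow> real \<Rightarrow> (real \<Rightarrow> real set) \<Rightarrow> (real \<Rightarrow> real set) \<Rightarrow>
   nat \<Rightarrow> real \<times> real set \<Rightarrow> real \<times> real set" where
  "ifs_map \<zeta> \<alpha> \<Phi> B i = (\<lambda>(s, S). (\<zeta> i s, \<alpha> \<odot> S + \<Phi> (\<zeta> i s) \<ominus> \<alpha> \<odot> B s))"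

definition graph_dist :: "(real \<Rightarrow> real set) \<Rightarrow> real \<times> real set \<Rightarrow> real \<times> real set \<Rightarrow> real" where
  "graph_dist f = (\<lambda>(s, S\<^sub>1) (w, S\<^sub>2). \<bar>s - w\<bar> + Hd (S\<^sub>1 + f w) (S\<^sub>2 + f s))"

definition graph_top :: "(nat \<Rightarrow> real) \<Rightarrow> real \<Rightarrow> (real \<Rightarrow> real set) \<Rightarrow> (real \<times> real set) topology" where
  "graph_top t tinf f = Metric_space.mtopology ({t 1..tinf} \<times> KcR) (graph_dist f)"

definition borel_of_top :: "'a topology \<Rightarrow> 'a measure" where
  "borel_of_top T = sigma (topspace T) {U. openin T U}"

(* The closed support: all points each of whose open neighbourhoods has positive measure. *)
definition measure_support :: "'a topology \<Rightarrow> 'a measure \<Rightarrow> 'a set" where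
  "measure_support T \<mu> = {x \<in> topspace T. \<forall>U. openin T U \<and> x \<in> U \<longrightarrow> emeasure \<mu> U > 0}"

(* \<mu> is a Borel probability measure on the space T with \<mu> = sum of p i * (\<mu> o (g i)^-1). *)
definition invariant_prob ::
  "'a topology \<Rightarrow> (nat \<Rightarrow> 'a \<Rightarrow> 'a) \<Rightarrow> (nat \<Rightarrow> real) \<Rightarrow> 'a measure \<Rightarrow> bool" where
  "invariant_prob T g p \<mu> \<longleftrightarrow>
     prob_space \<mu> \<and> space \<mu> = topspace T \<and> sets \<mu> = sets (borel_of_top T) \<and>
     (\<forall>A\<in>sets \<mu>. ((\<lambda>i. p i * measure \<mu> (g i -` A \<inter> space \<mu>)) has_sum measure \<mu> A) {1..})"

lemma Hd_as_infdist:
  assumes "A \<in> KR" "B \<in> KR"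
  shows "Hd A B = max (SUP a\<in>A. infdist a B) (SUP b\<in>B. infdist b A)"
  using assms by (auto simp: Hd_def KR_def infdist_notempty dist_commute)

lemma Hd_le_iff:
  assumes "A \<in> KR" "B \<in> KR"
  shows "Hd A B \<le> r \<longleftrightarrow> (\<forall>a\<in>A. infdist a B \<le> r) \<and> (\<forall>b\<in>B. infdist b A \<le> r)"
proof -
  have bdd: "bdd_above ((\<lambda>a. infdist a Y) ` X)" if "X \<in> KR" for X Y :: "real set"
    using that by (auto simp: KR_def intro!: bounded_imp_bdd_above compact_imp_bounded
        compact_continuous_image continuous_intros)
  show ?thesis
    using assms bdd[OF assms(1), of B] bdd[OF assms(2), of A]
    by (auto simp: Hd_as_infdist cSUP_le_iff KR_def)
qed

lemma Metric_space_KR: "Metric_space KR Hd"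
proof
  show nonneg: "0 \<le> Hd A B" for A B
  proof (cases "A \<in> KR \<and> B \<in> KR")
    case True
    then obtain a where "a \<in> A" by (auto simp: KR_def)
    then show ?thesis
      using True Hd_le_iff[of A B "Hd A B"] infdist_nonneg[of a B] by (meson order.refl order.trans)
  qed (auto simp: Hd_def)
  show "Hd A B = Hd B A" for A B
    by (cases "A \<in> KR \<and> B \<in> KR") (auto simp: Hd_as_infdist max.commute, auto simp: Hd_def)
  show "Hd A B = 0 \<longleftrightarrow> A = B" if "A \<in> KR" "B \<in> KR" for A B
  proof -
    have "Hd A B = 0 \<longleftrightarrow> Hd A B \<le> 0" using nonneg[of A B] by linarith
    also have "\<dots> \<longleftrightarrow> (\<forall>a\<in>A. infdist a B = 0) \<and> (\<forall>b\<in>B. infdist b A = 0)"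
      unfolding Hd_le_iff[OF that] using infdist_nonneg by (metis order.antisym order.refl)
    also have "\<dots> \<longleftrightarrow> A = B"
    proof -
      have "x \<in> A \<longleftrightarrow> infdist x A = 0" "x \<in> B \<longleftrightarrow> infdist x B = 0" for x
        using that by (auto simp: KR_def compact_imp_closed in_closed_iff_infdist_zero)
      then show ?thesis by blast
    qed
    finally show ?thesis .
  qed
  show "Hd A C \<le> Hd A B + Hd B C" if "A \<in> KR" "B \<in> KR" "C \<in> KR" for A B C
  proof -
    have aux: "infdist x Z \<le> r + s"
      if "Y \<in> KR" "infdist x Y \<le> r" "\<forall>y\<in>Y. infdist y Z \<le> s" for x r s and Y Z :: "real set"
    proof -
      obtain y where y: "y \<in> Y" "infdist x Y = dist x y"
        using infdist_attains_inf[of Y x] \<open>Y \<in> KR\<close> unfolding KR_def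
        by (metis (mono_tags, lifting) compact_imp_closed mem_Collect_eq)
      then have "infdist y Z \<le> s" using that by blast
      then show ?thesis using y that(2) infdist_triangle[of x Z y] by linarith
    qed
    have 1: "\<forall>a\<in>A. infdist a B \<le> Hd A B" "\<forall>b\<in>B. infdist b A \<le> Hd A B"
            "\<forall>b\<in>B. infdist b C \<le> Hd B C" "\<forall>c\<in>C. infdist c B \<le> Hd B C"
      using Hd_le_iff that by blast+
    show ?thesis
      unfolding Hd_le_iff[OF that(1,3)]
      using aux[OF that(2) _ 1(3)] aux[OF that(2) _ 1(2)] 1(1,4) by (metis add.commute)
  qed
qed

lemma Metric_space_KcR: "Metric_space KcR Hd"
proof -
  interpret Metric_space KR Hd by (rule Metric_space_KR)
  show ?thesis by (rule subspace) (auto simp: KR_def KcR_def)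
qed

lemma KcR_interval:
  assumes "S \<in> KcR"
  obtains a b where "a \<le> b" "S = {a..b}"
proof -
  have "connected S" "compact S" "S \<noteq> {}"
    using assms by (auto simp: KcR_def convex_connected)
  then obtain a b where "S = {a..b}"
    using connected_compact_interval_1[of S] by (auto simp: cbox_interval)
  then show ?thesis using that \<open>S \<noteq> {}\<close> by auto
qed

lemma interval_plus:
  fixes a b c d :: real
  assumes "a \<le> b" "c \<le> d"
  shows "{a..b} + {c..d} = {a + c..b + d}"
proof (intro set_eqI iffI)
  fix x assume x: "x \<in> {a + c..b + d}"
  define y where "y = max a (x - d)"
  have "y \<in> {a..b}" "x - y \<in> {c..d}" using x assms by (auto simp: y_def)
  then show "x \<in> {a..b} + {c..d}" using set_plus_intro[of y "{a..b}" "x - y"] by simp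
qed (auto simp: set_plus_def)

lemma Hd_interval:
  assumes "a \<le> b" "c \<le> d"
  shows "Hd {a..b} {c..d} = max \<bar>a - c\<bar> \<bar>b - d\<bar>"
proof -
  have le: "infdist x {c..d} \<le> r \<longleftrightarrow> c - r \<le> x \<and> x \<le> d + r \<and> 0 \<le> r" if "c \<le> d" for x c d r :: real
  proof
    assume *: "infdist x {c..d} \<le> r"
    obtain y where "y \<in> {c..d}" "infdist x {c..d} = dist x y"
      using infdist_attains_inf[OF closed_atLeastAtMost, of c d x] \<open>c \<le> d\<close>
      by (metis atLeastatMost_empty_iff2)
    then show "c - r \<le> x \<and> x \<le> d + r \<and> 0 \<le> r" using * by (auto simp: dist_real_def)
  next
    assume *: "c - r \<le> x \<and> x \<le> d + r \<and> 0 \<le> r"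
    show "infdist x {c..d} \<le> r"
      by (rule infdist_le2[of "max c (min x d)"]) (use * that in \<open>auto simp: dist_real_def max_def min_def\<close>)
  qed
  have K: "{a..b} \<in> KR" "{c..d} \<in> KR" using assms by (auto simp: KR_def)
  have iff: "Hd {a..b} {c..d} \<le> r \<longleftrightarrow> max \<bar>a - c\<bar> \<bar>b - d\<bar> \<le> r" for r
  proof -
    have "(\<forall>x\<in>{a..b}. c - r \<le> x \<and> x \<le> d + r \<and> 0 \<le> r) \<longleftrightarrow> c - r \<le> a \<and> b \<le> d + r \<and> 0 \<le> r"
      using assms by force
    moreover have "(\<forall>x\<in>{c..d}. a - r \<le> x \<and> x \<le> b + r \<and> 0 \<le> r) \<longleftrightarrow> a - r \<le> c \<and> d \<le> b + r \<and> 0 \<le> r"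
      using assms by force
    ultimately show ?thesis
      unfolding Hd_le_iff[OF K] by (simp add: le assms) linarith
  qed
  show ?thesis using iff[of "Hd {a..b} {c..d}"] iff[of "max \<bar>a - c\<bar> \<bar>b - d\<bar>"] by linarith
qed

lemma Metric_space_graph_dist:
  assumes f: "\<And>s. s \<in> I \<Longrightarrow> f s \<in> KcR"
  shows "Metric_space (I \<times> KcR) (graph_dist f)"
proof -
  interpret K: Metric_space KR Hd by (rule Metric_space_KR)
  have main: "graph_dist f (s, {a..b}) (w, {c..d}) =
      \<bar>s - w\<bar> + max \<bar>a + l w - (c + l s)\<bar> \<bar>b + u w - (d + u s)\<bar>"
    if "a \<le> b" "c \<le> d" "f s = {l s..u s}" "f w = {l w..u w}" "l s \<le> u s" "l w \<le> u w"
    for s w a b c d and l u :: "real \<Rightarrow> real"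
    using that by (simp add: graph_dist_def interval_plus Hd_interval)
  have "\<forall>s\<in>I. \<exists>l u. l \<le> u \<and> f s = {l..u}" using f KcR_interval by metis
  then obtain l u where lu: "\<And>s. s \<in> I \<Longrightarrow> l s \<le> u s \<and> f s = {l s..u s}" by metis
  have main': "graph_dist f (s, {a..b}) (w, {c..d}) =
      \<bar>s - w\<bar> + max \<bar>a + l w - (c + l s)\<bar> \<bar>b + u w - (d + u s)\<bar>"
    if "a \<le> b" "c \<le> d" "s \<in> I" "w \<in> I" for s w a b c d
    using main[of a b c d s l u w] that lu by blast
  have I: "\<exists>s a b. s \<in> I \<and> a \<le> b \<and> x = (s, {a..b})" if "x \<in> I \<times> KcR" for x
    using that by (metis KcR_interval SigmaE)
  have tri: "\<bar>s - v\<bar> + max \<bar>p\<bar> \<bar>q\<bar> \<le> (\<bar>s - w\<bar> + max \<bar>p'\<bar> \<bar>q'\<bar>) + (\<bar>w - v\<bar> + max \<bar>p''\<bar> \<bar>q''\<bar>)"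
    if "p = p' + p''" "q = q' + q''" for s v w p p' p'' q q' q'' :: real
    using that abs_triangle_ineq[of "s - w" "w - v"] abs_triangle_ineq[of p' p''] abs_triangle_ineq[of q' q'']
    by (simp add: max_def)
  show ?thesis
  proof
    show "0 \<le> graph_dist f x y" for x y by (simp add: graph_dist_def split: prod.split)
    show "graph_dist f x y = graph_dist f y x" for x y
      by (simp add: graph_dist_def K.commute abs_minus_commute split: prod.split)
    show "graph_dist f x y = 0 \<longleftrightarrow> x = y" if xy: "x \<in> I \<times> KcR" "y \<in> I \<times> KcR" for x y
    proof -
      obtain s a b where x: "s \<in> I" "a \<le> b" "x = (s, {a..b})" using I xy by blast
      obtain w c d where y: "w \<in> I" "c \<le> d" "y = (w, {c..d})" using I xy by blast
      have "graph_dist f x y = 0 \<longleftrightarrow> s = w \<and> a = c \<and> b = d"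
      proof
        assume *: "graph_dist f x y = 0"
        then have 0: "\<bar>s - w\<bar> + max \<bar>a + l w - (c + l s)\<bar> \<bar>b + u w - (d + u s)\<bar> = 0"
          unfolding x y main'[OF x(2) y(2) x(1) y(1)] .
        then have "s = w" by linarith
        with 0 show "s = w \<and> a = c \<and> b = d" by (simp add: max_def split: if_splits)
      next
        assume "s = w \<and> a = c \<and> b = d"
        then show "graph_dist f x y = 0"
          unfolding x y main'[OF x(2) y(2) x(1) y(1)] by simp
      qed
      then show ?thesis using x y by auto
    qed
    show "graph_dist f x z \<le> graph_dist f x y + graph_dist f y z"
      if xyz: "x \<in> I \<times> KcR" "y \<in> I \<times> KcR" "z \<in> I \<times> KcR" for x y z
    proof -
      obtain s a b where x: "s \<in> I" "a \<le> b" "x = (s, {a..b})" using I xyz by blast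
      obtain w c d where y: "w \<in> I" "c \<le> d" "y = (w, {c..d})" using I xyz by blast
      obtain v e g where z: "v \<in> I" "e \<le> g" "z = (v, {e..g})" using I xyz by blast
      show ?thesis
        unfolding x y z main'[OF x(2) y(2) x(1) y(1)] main'[OF x(2) z(2) x(1) z(1)]
          main'[OF y(2) z(2) y(1) z(1)]
        by (rule tri) simp_all
    qed
  qed
qed

end

theory Submission
  imports Defs
begin

text \<open>
  In the metric \<open>D\<close> the maps \<open>G\<^sub>i\<close> contract vertically by \<open>\<bar>\<alpha>\<bar>\<close> and preserve the graph of \<open>\<Phi>\<^sup>\<alpha>\<close>; hence
  the \<open>D\<close>-distance of a point to the graph point above the same abscissa shrinks by \<open>\<bar>\<alpha>\<bar>\<close> under every
  \<open>G\<^sub>i\<close>, and every invariant probability measure is carried by the graph. Since \<open>s \<mapsto> (s, \<Phi>\<^sup>\<alpha>(s))\<close>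
  is an isometry of the interval \<open>I\<close> into \<open>(X, D)\<close> that conjugates \<open>\<zeta>\<^sub>i\<close> to \<open>G\<^sub>i\<close>, what remains is the
  system \<open>(\<zeta>\<^sub>i)\<close> on \<open>I\<close>.

  The ratios \<open>a\<^sub>i\<close> may accumulate at \<open>1\<close>, but their mean \<open>\<Sum>\<^sub>i p\<^sub>i a\<^sub>i\<close> is less than \<open>1\<close>, so the transfer
  operator \<open>g \<mapsto> \<Sum>\<^sub>i p\<^sub>i g \<circ> \<zeta>\<^sub>i\<close> contracts Lipschitz constants. Tested on characters this gives uniqueness
  of the invariant measure on \<open>I\<close>, and, together with tightness, existence.

  The support \<open>K\<close> of that measure is closed, nonempty, mapped into itself by every \<open>\<zeta>\<^sub>i\<close>, and contains
  the limit \<open>t\<^sub>\<infinity>\<close> of the \<open>\<zeta>\<^sub>n(K)\<close>. A point of \<open>I\<close> farthest from \<open>K\<close> that differs from \<open>t\<^sub>\<infinity>\<close> is some \<open>\<zeta>\<^sub>i(w)\<close>,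
  and \<open>a\<^sub>i < 1\<close> forces its distance to \<open>K\<close> to be \<open>0\<close>; hence \<open>K = I\<close>.
\<close>

section \<open>Averaged contractions of an interval\<close>

locale random_contractions =
  fixes P :: "nat pmf" and Y :: "nat \<Rightarrow> real \<Rightarrow> real" and a :: "nat \<Rightarrow> real" and l u :: real
  assumes lip: "\<And>i. (a i)-lipschitz_on UNIV (Y i)"
    and contr: "\<And>i. a i < 1"
    and range: "\<And>i x. Y i x \<in> {l..u}"
begin

text \<open>The law of \<open>Y i x\<close> for independent \<open>i\<close> and \<open>x\<close>
  with laws \<open>P\<close> and \<open>\<nu>\<close>. Writing it as one image measure instead of a
  series makes Fubini applicable.\<close>

definition step :: "real measure \<Rightarrow> real measure" where
  "step \<nu> = distr (measure_pmf P \<Otimes>\<^sub>M \<nu>) borel (\<lambda>(i, x). Y i x)"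

text \<open>The transfer operator dual to \<open>step\<close>; complex values admit characters as
  test functions.\<close>

definition avg :: "(real \<Rightarrow> complex) \<Rightarrow> real \<Rightarrow> complex" where
  "avg g x = (\<integral>i. g (Y i x) \<partial>measure_pmf P)"

definition mean_ratio :: real where
  "mean_ratio = (\<integral>i. a i \<partial>measure_pmf P)"

lemma ratio_nonneg: "0 \<le> a i"
  using lip lipschitz_on_nonneg by blast

lemma integrable_ratio: "integrable (measure_pmf P) a"
  by (rule measure_pmf.integrable_const_bound[where B = 1])
    (use ratio_nonneg contr in \<open>auto simp: less_imp_le\<close>)

lemma mean_ratio_nonneg: "0 \<le> mean_ratio"
  unfolding mean_ratio_def by (rule Bochner_Integration.integral_nonneg) (rule ratio_nonneg)

text \<open>A pointwise strict inequality survives integration over a probability measure, even if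
  the supremum of the ratios is \<open>1\<close>.\<close>

lemma mean_ratio_less_1: "mean_ratio < 1"
proof -
  have "mean_ratio < (\<integral>i. 1 \<partial>measure_pmf P)"
    unfolding mean_ratio_def
    by (rule measure_pmf.integral_less_AE_space)
      (use integrable_ratio contr in \<open>auto simp: measure_pmf.emeasure_space_1\<close>)
  then show ?thesis by simp
qed

lemma Y_borel [measurable]: "Y i \<in> borel_measurable borel"
  by (intro borel_measurable_continuous_onI lipschitz_on_continuous_on[OF lip])

lemma Y_joint_borel:
  assumes "sets \<nu> = sets borel"
  shows "(\<lambda>(i, x). Y i x) \<in> borel_measurable (measure_pmf P \<Otimes>\<^sub>M \<nu>)"
proof -
  have "(\<lambda>(i, x). Y i x) \<in> borel_measurable (count_space UNIV \<Otimes>\<^sub>M borel)"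
    by (rule measurable_pair_measure_countable1) auto
  moreover have "sets (measure_pmf P \<Otimes>\<^sub>M \<nu>) = sets (count_space UNIV \<Otimes>\<^sub>M borel)"
    by (intro sets_pair_measure_cong) (simp_all add: assms)
  ultimately show ?thesis
    using measurable_cong_sets by blast
qed

section \<open>The action on measures\<close>

lemma real_distribution_step:
  assumes "real_distribution \<nu>"
  shows "real_distribution (step \<nu>)"
proof -
  interpret \<nu>: real_distribution \<nu> by fact
  interpret pair_prob_space "measure_pmf P" \<nu> ..
  show ?thesis
    unfolding step_def real_distribution_def real_distribution_axioms_def
    by (auto intro!: prob_space_distr Y_joint_borel)
qed

lemma emeasure_step:
  assumes "real_distribution \<nu>" and A: "A \<in> sets borel"
  shows "emeasure (step \<nu>) A = (\<integral>\<^sup>+i. emeasure \<nu> (Y i -` A) \<partial>measure_pmf P)"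
proof -
  interpret \<nu>: real_distribution \<nu> by fact
  have sp: "space (measure_pmf P \<Otimes>\<^sub>M \<nu>) = UNIV"
    by (simp add: space_pair_measure)
  note m = Y_joint_borel[of \<nu>, OF \<nu>.events_eq_borel]
  have S: "(\<lambda>(i, x). Y i x) -` A \<in> sets (measure_pmf P \<Otimes>\<^sub>M \<nu>)"
    using measurable_sets[OF m A] by (simp add: sp)
  have "emeasure (step \<nu>) A = emeasure (measure_pmf P \<Otimes>\<^sub>M \<nu>) ((\<lambda>(i, x). Y i x) -` A)"
    unfolding step_def using emeasure_distr[OF m A] by (simp add: sp)
  also have "\<dots> = (\<integral>\<^sup>+i. emeasure \<nu> (Pair i -` ((\<lambda>(i, x). Y i x) -` A)) \<partial>measure_pmf P)"
    by (rule \<nu>.emeasure_pair_measure_alt[OF S])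
  also have "\<dots> = (\<integral>\<^sup>+i. emeasure \<nu> (Y i -` A) \<partial>measure_pmf P)"
    by (simp add: vimage_def)
  finally show ?thesis .
qed

lemma has_sum_measure_step:
  assumes "real_distribution \<nu>" and A: "A \<in> sets borel"
  shows "((\<lambda>i. pmf P i * measure \<nu> (Y i -` A)) has_sum measure (step \<nu>) A) UNIV"
proof -
  interpret \<nu>: real_distribution \<nu> by fact
  interpret s: real_distribution "step \<nu>" by (rule real_distribution_step[OF assms(1)])
  have "ennreal (measure (step \<nu>) A) = (\<Sum>i. ennreal (pmf P i) * emeasure \<nu> (Y i -` A))"
    using emeasure_step[OF assms]
    by (simp add: nn_integral_measure_pmf nn_integral_count_space_nat s.emeasure_eq_measure)
  also have "\<dots> = (\<Sum>i. ennreal (pmf P i * measure \<nu> (Y i -` A)))"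
    by (simp add: \<nu>.emeasure_eq_measure ennreal_mult')
  finally have "(\<lambda>i. ennreal (pmf P i * measure \<nu> (Y i -` A))) sums ennreal (measure (step \<nu>) A)"
    by (simp add: summable_sums)
  then have "(\<lambda>i. pmf P i * measure \<nu> (Y i -` A)) sums measure (step \<nu>) A"
    by (subst (asm) sums_ennreal) auto
  then show ?thesis
    by (rule sums_nonneg_imp_has_sum) auto
qed

section \<open>The action on bounded Lipschitz functions\<close>

lemma norm_avg_le:
  fixes g :: "real \<Rightarrow> complex"
  assumes "\<And>x. norm (g x) \<le> C"
  shows "norm (avg g x) \<le> C"
proof -
  have "norm (avg g x) \<le> (\<integral>i. norm (g (Y i x)) \<partial>measure_pmf P)"
    unfolding avg_def by (rule integral_norm_bound)
  also have "\<dots> \<le> (\<integral>i. C \<partial>measure_pmf P)"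
    by (rule integral_mono) (use assms in \<open>auto intro!: measure_pmf.integrable_const_bound[where B = C]\<close>)
  finally show ?thesis by simp
qed

text \<open>Composition with \<open>Y i\<close> turns the constant into \<open>a i * K\<close>, and
  averaging replaces \<open>a i\<close> by its mean. The bound on \<open>g\<close> provides
  integrability.\<close>

lemma lipschitz_avg:
  fixes g :: "real \<Rightarrow> complex"
  assumes g: "K-lipschitz_on UNIV g" and bdd: "\<And>x. norm (g x) \<le> C"
  shows "(mean_ratio * K)-lipschitz_on UNIV (avg g)"
proof (rule lipschitz_onI)
  have K: "0 \<le> K" using g by (rule lipschitz_on_nonneg)
  then show "0 \<le> mean_ratio * K" using mean_ratio_nonneg by simp
  have int: "integrable (measure_pmf P) (\<lambda>i. g (Y i x))" for x
    using bdd by (auto intro!: measure_pmf.integrable_const_bound[where B = C])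
  fix x y :: real
  have "dist (avg g x) (avg g y) = norm (\<integral>i. g (Y i x) - g (Y i y) \<partial>measure_pmf P)"
    by (simp add: dist_norm avg_def int)
  also have "\<dots> \<le> (\<integral>i. norm (g (Y i x) - g (Y i y)) \<partial>measure_pmf P)"
    by (rule integral_norm_bound)
  also have "\<dots> \<le> (\<integral>i. a i * (K * dist x y) \<partial>measure_pmf P)"
  proof (rule integral_mono)
    fix i
    have "norm (g (Y i x) - g (Y i y)) \<le> K * dist (Y i x) (Y i y)"
      using lipschitz_onD[OF g] by (simp add: dist_norm)
    also have "\<dots> \<le> K * (a i * dist x y)"
      using lipschitz_onD[OF lip[of i]] K by (simp add: mult_left_mono)
    finally show "norm (g (Y i x) - g (Y i y)) \<le> a i * (K * dist x y)"
      by (simp add: mult_ac)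
  qed (use int integrable_ratio in auto)
  also have "\<dots> = mean_ratio * K * dist x y"
    by (simp add: mean_ratio_def)
  finally show "dist (avg g x) (avg g y) \<le> mean_ratio * K * dist x y" .
qed

text \<open>Fubini for the product of \<open>P\<close> and \<open>\<nu>\<close>: \<open>step\<close>
  and \<open>avg\<close> are adjoint.\<close>

lemma integral_step:
  fixes g :: "real \<Rightarrow> complex"
  assumes "real_distribution \<nu>" and g: "K-lipschitz_on UNIV g" and bdd: "\<And>x. norm (g x) \<le> C"
  shows "integral\<^sup>L (step \<nu>) g = integral\<^sup>L \<nu> (avg g)"
proof -
  interpret \<nu>: real_distribution \<nu> by fact
  interpret pair_prob_space "measure_pmf P" \<nu> ..
  note m = Y_joint_borel[of \<nu>, OF \<nu>.events_eq_borel]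
  have gm: "g \<in> borel_measurable borel"
    by (intro borel_measurable_continuous_onI lipschitz_on_continuous_on[OF g])
  have "(\<lambda>z. g ((\<lambda>(i, x). Y i x) z)) \<in> borel_measurable (measure_pmf P \<Otimes>\<^sub>M \<nu>)"
    by (rule measurable_compose[OF m gm])
  then have int: "integrable (measure_pmf P \<Otimes>\<^sub>M \<nu>) (case_prod (\<lambda>i x. g (Y i x)))"
    using bdd by (intro integrable_const_bound[where B = C]) (auto simp: case_prod_unfold)
  show ?thesis
    unfolding step_def avg_def integral_distr[OF m gm] using integral_snd[OF int]
    by (simp add: case_prod_unfold)
qed

text \<open>One step moves all mass into \<open>{l..u}\<close>, whatever the initial measures are;
  there \<open>g\<close> differs from \<open>g l\<close> by at most \<open>K * (u - l)\<close>. Both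
  integrals are compared with \<open>g l\<close>, hence the factor 2.\<close>

lemma integral_step_diff_le:
  fixes g :: "real \<Rightarrow> complex"
  assumes "real_distribution \<nu>" "real_distribution \<nu>'"
    and g: "K-lipschitz_on UNIV g" and bdd: "\<And>x. norm (g x) \<le> C"
  shows "norm (integral\<^sup>L (step \<nu>) g - integral\<^sup>L (step \<nu>') g) \<le> 2 * K * (u - l)"
proof -
  have *: "norm (integral\<^sup>L (step \<nu>) g - g l) \<le> K * (u - l)" if "real_distribution \<nu>" for \<nu>
  proof -
    interpret \<nu>: real_distribution \<nu> by fact
    have gm: "avg g \<in> borel_measurable borel"
      by (intro borel_measurable_continuous_onI lipschitz_on_continuous_on[OF lipschitz_avg[OF g bdd]])
    have int: "integrable \<nu> (avg g)"
      using norm_avg_le[OF bdd] gm by (auto intro!: \<nu>.integrable_const_bound[where B = C])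
    have "norm (avg g x - g l) \<le> K * (u - l)" for x
    proof -
      have int': "integrable (measure_pmf P) (\<lambda>i. g (Y i x))"
        using bdd by (auto intro!: measure_pmf.integrable_const_bound[where B = C])
      have "norm (avg g x - g l) = norm (\<integral>i. g (Y i x) - g l \<partial>measure_pmf P)"
        by (simp add: avg_def int')
      also have "\<dots> \<le> (\<integral>i. norm (g (Y i x) - g l) \<partial>measure_pmf P)"
        by (rule integral_norm_bound)
      also have "\<dots> \<le> (\<integral>i. K * (u - l) \<partial>measure_pmf P)"
      proof (rule integral_mono)
        fix i
        have "norm (g (Y i x) - g l) \<le> K * dist (Y i x) l"
          using lipschitz_onD[OF g] by (simp add: dist_norm)
        also have "\<dots> \<le> K * (u - l)"
          using range[of i x] lipschitz_on_nonneg[OF g] by (simp add: dist_real_def mult_left_mono)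
        finally show "norm (g (Y i x) - g l) \<le> K * (u - l)" .
      qed (use int' in auto)
      finally show ?thesis by simp
    qed
    then have "norm (\<integral>x. avg g x - g l \<partial>\<nu>) \<le> (\<integral>x. K * (u - l) \<partial>\<nu>)"
      by (intro order.trans[OF integral_norm_bound] integral_mono) (use int in auto)
    then show ?thesis
      using int \<nu>.prob_space by (simp add: integral_step[OF that g bdd] del: \<nu>.space_eq_univ)
  qed
  show ?thesis
    using norm_triangle_ineq4[of "integral\<^sup>L (step \<nu>) g - g l" "integral\<^sup>L (step \<nu>') g - g l"]
      *[OF assms(1)] *[OF assms(2)] by simp
qed

section \<open>Merging of orbits\<close>

lemma real_distribution_iterate:
  "real_distribution \<nu> \<Longrightarrow> real_distribution ((step ^^ n) \<nu>)"
  by (induction n) (auto intro: real_distribution_step)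

text \<open>Of the \<open>Suc n\<close> steps, \<open>n\<close> are moved to the test function, each
  multiplying its Lipschitz constant by \<open>mean_ratio\<close>; the innermost one confines the
  mass to \<open>{l..u}\<close>.\<close>

lemma integral_iterate_diff_le:
  fixes g :: "real \<Rightarrow> complex"
  assumes \<nu>: "real_distribution \<nu>" "real_distribution \<nu>'"
    and "K-lipschitz_on UNIV g" and "\<And>x. norm (g x) \<le> C"
  shows "norm (integral\<^sup>L ((step ^^ Suc n) \<nu>) g - integral\<^sup>L ((step ^^ Suc n) \<nu>') g)
           \<le> 2 * (mean_ratio ^ n * K) * (u - l)"
  using assms(3,4)
proof (induction n arbitrary: g K)
  case 0
  then show ?case using integral_step_diff_le[OF \<nu> 0] by simp
next
  case (Suc n)
  have "integral\<^sup>L ((step ^^ Suc (Suc n)) \<nu>) g = integral\<^sup>L ((step ^^ Suc n) \<nu>) (avg g)"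
    if "real_distribution \<nu>" for \<nu>
    using integral_step[OF real_distribution_iterate[OF that, of "Suc n"] Suc.prems] by simp
  then show ?case
    using Suc.IH[OF lipschitz_avg[OF Suc.prems] norm_avg_le[OF Suc.prems(2)]] \<nu>
    by (simp add: mult_ac)
qed

lemma integral_iterate_diff_tendsto_0:
  fixes g :: "real \<Rightarrow> complex"
  assumes \<nu>: "real_distribution \<nu>" "real_distribution \<nu>'"
    and g: "K-lipschitz_on UNIV g" and bdd: "\<And>x. norm (g x) \<le> C"
  shows "(\<lambda>n. integral\<^sup>L ((step ^^ n) \<nu>) g - integral\<^sup>L ((step ^^ n) \<nu>') g) \<longlonglongrightarrow> 0"
proof -
  have lim: "(\<lambda>n. 2 * (mean_ratio ^ n * K) * (u - l)) \<longlonglongrightarrow> 2 * (0 * K) * (u - l)"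
    by (intro tendsto_intros LIMSEQ_realpow_zero mean_ratio_nonneg mean_ratio_less_1)
  have "(\<lambda>n. integral\<^sup>L ((step ^^ Suc n) \<nu>) g - integral\<^sup>L ((step ^^ Suc n) \<nu>') g) \<longlonglongrightarrow> 0"
  proof (rule Lim_null_comparison)
    show "\<forall>\<^sub>F n in sequentially. norm (integral\<^sup>L ((step ^^ Suc n) \<nu>) g - integral\<^sup>L ((step ^^ Suc n) \<nu>') g)
            \<le> 2 * (mean_ratio ^ n * K) * (u - l)"
      using integral_iterate_diff_le[OF assms] by (intro always_eventually allI)
    show "(\<lambda>n. 2 * (mean_ratio ^ n * K) * (u - l)) \<longlonglongrightarrow> 0"
      using lim by simp
  qed
  then show ?thesis by (rule LIMSEQ_imp_Suc)
qed

section \<open>Characters and the unique fixed measure\<close>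

lemma iexp_lipschitz: "\<bar>s\<bar>-lipschitz_on UNIV (\<lambda>x. iexp (s * x))"
proof (rule lipschitz_onI)
  fix x y :: real
  have "norm (iexp (s * x) - iexp (s * y)) = norm (iexp (s * y) * (iexp (s * x - s * y) - 1))"
    by (simp add: algebra_simps flip: exp_add)
  also have "\<dots> = norm (iexp (s * x - s * y) - 1)"
    by (simp add: norm_mult)
  also have "\<dots> \<le> \<bar>s * x - s * y\<bar>"
    using iexp_approx1[of "s * x - s * y" 0] by simp
  also have "\<dots> = \<bar>s\<bar> * \<bar>x - y\<bar>"
    by (simp add: abs_mult flip: right_diff_distrib)
  finally show "dist (iexp (s * x)) (iexp (s * y)) \<le> \<bar>s\<bar> * dist x y"
    by (simp add: dist_norm)
qed simp

text \<open>Fixed measures do not move under \<open>step\<close>, so the merging differences of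
  their characteristic functions are constant sequences tending to zero.\<close>

lemma step_fixed_unique:
  assumes \<nu>: "real_distribution \<nu>" "real_distribution \<nu>'" and fix1: "step \<nu> = \<nu>" "step \<nu>' = \<nu>'"
  shows "\<nu> = \<nu>'"
proof (rule Levy_uniqueness[OF \<nu>])
  have iter: "(step ^^ n) \<nu> = \<nu>" "(step ^^ n) \<nu>' = \<nu>'" for n
    by (induction n) (simp_all add: fix1)
  have "(\<lambda>n::nat. char \<nu> s - char \<nu>' s) \<longlonglongrightarrow> 0" for s
    using integral_iterate_diff_tendsto_0[OF \<nu> iexp_lipschitz[of s], of 1]
    by (simp add: iter char_def)
  then show "char \<nu> = char \<nu>'"
    by (auto simp: LIMSEQ_const_iff)
qed

text \<open>A weak subsequential limit of the orbit of a point mass is fixed, because the integrals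
  of each orbit member and its successor merge.\<close>

lemma step_fixed_exists:
  obtains \<nu> where "real_distribution \<nu>" "step \<nu> = \<nu>"
proof -
  \<comment> \<open>The orbit is taken after one step, since the point \<open>0\<close> may lie
    outside \<open>{l..u}\<close>.\<close>
  define \<mu> where "\<mu> = (\<lambda>n. (step ^^ Suc n) (return borel 0))"
  have rd0: "real_distribution (return borel (0::real))"
    by (auto simp: real_distribution_def real_distribution_axioms_def intro: prob_space_return)
  have rd: "real_distribution (\<mu> n)" for n
    unfolding \<mu>_def by (rule real_distribution_iterate[OF rd0])
  \<comment> \<open>Tightness is formulated with intervals open on the left, so \<open>l\<close> is
    lowered to \<open>l - 1\<close>; this also keeps the interval nondegenerate when
    \<open>l = u\<close>.\<close>
  have "measure (\<mu> n) {l - 1<..u} = 1" for n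
  proof -
    interpret d: real_distribution "\<mu> n" by (rule rd)
    have rd': "real_distribution ((step ^^ n) (return borel 0))"
      by (rule real_distribution_iterate[OF rd0])
    interpret d': real_distribution "(step ^^ n) (return borel 0)" by (rule rd')
    have "Y i -` {l - 1<..u} = UNIV" for i
    proof -
      have "l - 1 < Y i x \<and> Y i x \<le> u" for x using range[of i x] by auto
      then show ?thesis by auto
    qed
    then have "emeasure (\<mu> n) {l - 1<..u} = 1"
      using emeasure_step[OF rd', of "{l - 1<..u}"] d'.emeasure_space_1
      by (simp add: \<mu>_def measure_pmf.emeasure_space_1)
    then show ?thesis by (simp add: measure_def)
  qed
  moreover have "l - 1 < u" using range[of 0 0] by simp
  ultimately have "tight \<mu>"
    unfolding tight_def using rd by (metis diff_less_eq less_add_same_cancel1)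
  then obtain r \<nu> where r: "strict_mono (r :: nat \<Rightarrow> nat)" and \<nu>: "real_distribution \<nu>"
    and "weak_conv_m (\<mu> \<circ> id \<circ> r) \<nu>"
    using tight_imp_convergent_subsubsequence[of \<mu> id] strict_mono_id by blast
  then have wc: "weak_conv_m (\<lambda>k. \<mu> (r k)) \<nu>" by (simp add: comp_def)
  interpret \<nu>: real_distribution \<nu> by (rule \<nu>)
  have lim: "(\<lambda>k. integral\<^sup>L (\<mu> (r k)) g) \<longlonglongrightarrow> integral\<^sup>L \<nu> g"
    if "K-lipschitz_on UNIV g" "\<And>x. norm (g x) \<le> C" for K C and g :: "real \<Rightarrow> complex"
  proof (rule weak_conv_imp_integral_bdd_continuous_conv[OF _ \<nu> wc])
    show "isCont g x" for x
      using lipschitz_on_continuous_on[OF that(1)] continuous_on_eq_continuous_at[OF open_UNIV] by blast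
  qed (use rd that in auto)
  have "step \<nu> = \<nu>"
  proof (rule Levy_uniqueness[OF real_distribution_step[OF \<nu>] \<nu>], rule ext)
    fix s
    let ?g = "\<lambda>x. iexp (s * x)"
    have bdd: "norm (?g x) \<le> 1" for x by simp
    note g = iexp_lipschitz[of s]
    \<comment> \<open>\<open>avg ?g\<close> is again bounded and Lipschitz, so weak convergence
      applies to it, and duality turns it back into \<open>step\<close>.\<close>
    have "(\<lambda>k. integral\<^sup>L (\<mu> (r k)) (avg ?g)) \<longlonglongrightarrow> integral\<^sup>L \<nu> (avg ?g)"
      by (rule lim[OF lipschitz_avg[OF g bdd] norm_avg_le[OF bdd]])
    then have 1: "(\<lambda>k. integral\<^sup>L (step (\<mu> (r k))) ?g) \<longlonglongrightarrow> integral\<^sup>L (step \<nu>) ?g"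
      by (simp only: integral_step[OF rd g bdd] integral_step[OF \<nu> g bdd])
    \<comment> \<open>The orbit of \<open>step (return borel 0)\<close> is the shifted orbit, so
      consecutive orbit members merge along the full sequence.\<close>
    have "(\<lambda>n. integral\<^sup>L ((step ^^ n) (step (return borel 0))) ?g
               - integral\<^sup>L ((step ^^ n) (return borel 0)) ?g) \<longlonglongrightarrow> 0"
      by (rule integral_iterate_diff_tendsto_0[OF real_distribution_step[OF rd0] rd0 g bdd])
    from LIMSEQ_Suc[OF this]
    have "(\<lambda>n. integral\<^sup>L (step (\<mu> n)) ?g - integral\<^sup>L (\<mu> n) ?g) \<longlonglongrightarrow> 0"
      by (simp add: \<mu>_def funpow_swap1)
    from LIMSEQ_subseq_LIMSEQ[OF this r]
    have "(\<lambda>k. integral\<^sup>L (step (\<mu> (r k))) ?g - integral\<^sup>L (\<mu> (r k)) ?g) \<longlonglongrightarrow> 0"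
      by (simp add: comp_def)
    from tendsto_diff[OF 1 this] have "(\<lambda>k. integral\<^sup>L (\<mu> (r k)) ?g) \<longlonglongrightarrow> integral\<^sup>L (step \<nu>) ?g"
      by simp
    then show "char (step \<nu>) s = char \<nu> s"
      unfolding char_def using lim[OF g bdd] LIMSEQ_unique by blast
  qed
  with \<nu> show thesis by (rule that)
qed

end

section \<open>Invariant measures on the real line\<close>

lemma borel_of_top_euclidean: "borel_of_top euclidean = (borel :: 'a::topological_space measure)"
  by (simp add: borel_of_top_def borel_def)

text \<open>Shifting the indices by one turns the weights into a probability mass function on all
  naturals; invariance then says precisely that \<open>\<nu>\<close> is a real distribution with
  \<open>step \<nu> = \<nu>\<close>.\<close>

lemma invariant_prob_real_unique:
  fixes Y :: "nat \<Rightarrow> real \<Rightarrow> real"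
  assumes lip: "\<And>i. i \<ge> 1 \<Longrightarrow> (a i)-lipschitz_on UNIV (Y i)" and a: "\<And>i. i \<ge> 1 \<Longrightarrow> a i < 1"
    and range: "\<And>i x. i \<ge> 1 \<Longrightarrow> Y i x \<in> {l..u}"
    and p0: "\<And>i. i \<ge> 1 \<Longrightarrow> 0 \<le> p i" and p1: "(p has_sum 1) {1..}"
  shows "\<exists>!\<nu>. invariant_prob euclidean Y p \<nu>"
proof -
  have Suc: "Suc ` UNIV = {1..}" by (auto simp: image_iff) (metis Suc_le_D)
  have reindex: "(h has_sum x) {1..} \<longleftrightarrow> ((\<lambda>i. h (Suc i)) has_sum x) UNIV" for h :: "nat \<Rightarrow> real" and x
    using has_sum_reindex[of Suc UNIV h x] by (simp add: Suc comp_def)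
  have "(\<lambda>i. p (Suc i)) sums 1"
    using p1 reindex[of p 1] by (simp add: has_sum_imp_sums)
  then have "(\<lambda>i. ennreal (p (Suc i))) sums ennreal 1"
    by (subst sums_ennreal) (auto intro: p0)
  then have "(\<integral>\<^sup>+i. ennreal (p (Suc i)) \<partial>count_space UNIV) = 1"
    by (simp add: nn_integral_count_space_nat sums_iff)
  then have pmf: "pmf (embed_pmf (\<lambda>i. p (Suc i))) i = p (Suc i)" for i
    by (intro pmf_embed_pmf) (auto intro: p0)
  interpret random_contractions "embed_pmf (\<lambda>i. p (Suc i))" "\<lambda>i. Y (Suc i)" "\<lambda>i. a (Suc i)" l u
    by standard (use lip a range in auto)
  have iff: "invariant_prob euclidean Y p \<nu> \<longleftrightarrow> real_distribution \<nu> \<and> step \<nu> = \<nu>" for \<nu>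
  proof -
    have sp: "sets \<nu> = sets borel \<Longrightarrow> space \<nu> = UNIV"
      using sets_eq_imp_space_eq[of \<nu> borel] by simp
    have "invariant_prob euclidean Y p \<nu> \<longleftrightarrow> real_distribution \<nu> \<and>
        (\<forall>A\<in>sets borel. ((\<lambda>i. p (Suc i) * measure \<nu> (Y (Suc i) -` A)) has_sum measure \<nu> A) UNIV)"
      unfolding invariant_prob_def real_distribution_def real_distribution_axioms_def
        borel_of_top_euclidean reindex
      by (auto simp: sp)
    also have "\<dots> \<longleftrightarrow> real_distribution \<nu> \<and> step \<nu> = \<nu>"
    proof (intro conj_cong refl iffI ballI)
      assume \<nu>: "real_distribution \<nu>"
      interpret \<nu>: real_distribution \<nu> by fact
      interpret s: real_distribution "step \<nu>" by (rule real_distribution_step[OF \<nu>])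
      {
        assume *: "\<forall>A\<in>sets borel. ((\<lambda>i. p (Suc i) * measure \<nu> (Y (Suc i) -` A)) has_sum measure \<nu> A) UNIV"
        show "step \<nu> = \<nu>"
        proof (rule measure_eqI)
          fix A assume "A \<in> sets (step \<nu>)"
          then have "A \<in> sets borel" by simp
          then have "measure (step \<nu>) A = measure \<nu> A"
            using has_sum_measure_step[OF \<nu>, of A] * has_sum_unique by (fastforce simp: pmf)
          then show "emeasure (step \<nu>) A = emeasure \<nu> A"
            by (simp add: s.emeasure_eq_measure \<nu>.emeasure_eq_measure)
        qed simp
      }
      {
        fix A :: "real set" assume "step \<nu> = \<nu>" "A \<in> sets borel"
        then show "((\<lambda>i. p (Suc i) * measure \<nu> (Y (Suc i) -` A)) has_sum measure \<nu> A) UNIV"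
          using has_sum_measure_step[OF \<nu>, of A] by (simp add: pmf)
      }
    qed
    finally show ?thesis .
  qed
  show ?thesis
    unfolding iff using step_fixed_exists step_fixed_unique by metis
qed

section \<open>Minkowski operations and the Hausdorff distance\<close>

lemma Hd_leI:
  assumes "A \<in> KR" "C \<in> KR"
    and "\<And>x. x \<in> A \<Longrightarrow> \<exists>y\<in>C. dist x y \<le> r" "\<And>y. y \<in> C \<Longrightarrow> \<exists>x\<in>A. dist x y \<le> r"
  shows "Hd A C \<le> r"
  unfolding Hd_le_iff[OF assms(1,2)] using assms(3,4) by (metis infdist_le2 dist_commute)

text \<open>Compactness yields a partner at distance at most \<open>Hd A C\<close> itself, with no
  additional epsilon.\<close>

lemma Hd_attained:
  assumes "A \<in> KR" "C \<in> KR" "x \<in> A"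
  obtains y where "y \<in> C" "dist x y \<le> Hd A C"
proof -
  have "closed C" "C \<noteq> {}" using assms by (auto simp: KR_def compact_imp_closed)
  then obtain y where "y \<in> C" "infdist x C = dist x y"
    using infdist_attains_inf by blast
  then show thesis
    using that Hd_le_iff[OF assms(1,2), of "Hd A C"] assms(3) by auto
qed

lemma Hd_commute: "Hd A C = Hd C A"
  using Metric_space.commute[OF Metric_space_KR] .

lemma KcR_subset_KR: "KcR \<subseteq> KR"
  by (auto simp: KcR_def KR_def)

lemma mink_scale_image: "c \<odot> A = (\<lambda>x. c *\<^sub>R x) ` A"
  by (auto simp: mink_scale_def)

text \<open>Reduces Minkowski differences to sums, which can be rearranged by commutativity and
  associativity.\<close>

lemma mink_diff_eq: "A \<ominus> C = A + -1 \<odot> C"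
  by (force simp: mink_diff_def mink_scale_def set_plus_def)

lemma mink_scale_plus: "c \<odot> (A + C) = c \<odot> A + c \<odot> C"
  by (force simp: mink_scale_def set_plus_def algebra_simps)

lemma mink_scale_scale: "c \<odot> d \<odot> A = (c * d) \<odot> A"
  by (auto simp: mink_scale_def mult.assoc)

lemma KR_plus: "A \<in> KR \<Longrightarrow> C \<in> KR \<Longrightarrow> A + C \<in> KR"
proof -
  assume *: "A \<in> KR" "C \<in> KR"
  have "A + C = {x + y |x y. x \<in> A \<and> y \<in> C}" by (auto simp: set_plus_def)
  then show "A + C \<in> KR" using * compact_sums[of A C] by (auto simp: KR_def)
qed

lemma KR_scale: "A \<in> KR \<Longrightarrow> c \<odot> A \<in> KR"
  using compact_scaling[of A c] by (simp add: KR_def mink_scale_image del: real_scaleR_def)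

lemma KR_hull: "A \<in> KR \<Longrightarrow> convex hull A \<in> KR"
  by (auto simp: KR_def intro: compact_convex_hull)

lemma KcR_iff: "A \<in> KcR \<longleftrightarrow> A \<in> KR \<and> convex A"
  by (auto simp: KcR_def KR_def)

lemma KcR_plus: "A \<in> KcR \<Longrightarrow> C \<in> KcR \<Longrightarrow> A + C \<in> KcR"
  by (simp add: KcR_iff KR_plus convex_set_plus)

lemma KcR_scale: "A \<in> KcR \<Longrightarrow> c \<odot> A \<in> KcR"
  using convex_scaling[of A c] KR_scale[of A c] by (simp add: KcR_iff mink_scale_image del: real_scaleR_def)

lemma Hd_plus_le:
  assumes "A \<in> KR" "C \<in> KR" "E \<in> KR"
  shows "Hd (A + E) (C + E) \<le> Hd A C"
proof -
  have *: "\<exists>y\<in>C + E. dist x y \<le> Hd A C" if AC: "A \<in> KR" "C \<in> KR" and xin: "x \<in> A + E" for A C x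
  proof -
    obtain b e where x: "x = b + e" "b \<in> A" "e \<in> E" using xin by (auto simp: set_plus_def)
    obtain c where "c \<in> C" "dist b c \<le> Hd A C" using Hd_attained[OF AC x(2)] .
    then show ?thesis using x by (intro bexI[of _ "c + e"]) (auto intro: set_plus_intro)
  qed
  show ?thesis
    using *[OF assms(1,2)] *[OF assms(2,1)]
    by (intro Hd_leI KR_plus assms) (simp_all add: dist_commute Hd_commute)
qed

lemma Hd_scale_le:
  assumes "A \<in> KR" "C \<in> KR"
  shows "Hd (c \<odot> A) (c \<odot> C) \<le> \<bar>c\<bar> * Hd A C"
proof -
  have *: "\<exists>y\<in>c \<odot> C. dist x y \<le> \<bar>c\<bar> * Hd A C" if AC: "A \<in> KR" "C \<in> KR" and xin: "x \<in> c \<odot> A" for A C x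
  proof -
    obtain b where x: "x = c * b" "b \<in> A" using xin by (auto simp: mink_scale_def)
    obtain d where d: "d \<in> C" "dist b d \<le> Hd A C" using Hd_attained[OF AC x(2)] .
    have "dist x (c * d) = \<bar>c\<bar> * dist b d"
      by (simp add: x dist_real_def abs_mult flip: right_diff_distrib)
    then show ?thesis using d by (intro bexI[of _ "c * d"]) (auto simp: mink_scale_def mult_left_mono)
  qed
  show ?thesis
    using *[OF assms(1,2)] *[OF assms(2,1)]
    by (intro Hd_leI KR_scale assms) (simp_all add: dist_commute Hd_commute)
qed

text \<open>\<open>A\<close> lies in the sum of \<open>convex hull C\<close> and a ball of radius
  \<open>Hd A C\<close>; that sum is convex, so it contains \<open>convex hull A\<close>.\<close>

lemma Hd_hull_le:
  assumes "A \<in> KR" "C \<in> KR"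
  shows "Hd (convex hull A) (convex hull C) \<le> Hd A C"
proof -
  have *: "\<exists>y\<in>convex hull C. dist x y \<le> Hd A C"
    if AC: "A \<in> KR" "C \<in> KR" and x: "x \<in> convex hull A" for A C x
  proof -
    have "A \<subseteq> convex hull C + cball 0 (Hd A C)"
    proof
      fix y assume "y \<in> A"
      then obtain z where z: "z \<in> C" "dist y z \<le> Hd A C" using Hd_attained[OF AC] by blast
      then have "z + (y - z) \<in> convex hull C + cball 0 (Hd A C)"
        by (intro set_plus_intro) (auto simp: hull_inc dist_real_def)
      then show "y \<in> convex hull C + cball 0 (Hd A C)" by simp
    qed
    then have "convex hull A \<subseteq> convex hull C + cball 0 (Hd A C)"
      by (intro hull_minimal convex_set_plus) auto
    then obtain y e where "x = y + e" "y \<in> convex hull C" "\<bar>e\<bar> \<le> Hd A C"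
      using x by (force simp: set_plus_def)
    then show ?thesis by (intro bexI[of _ y]) (auto simp: dist_real_def)
  qed
  show ?thesis
    using *[OF assms(1,2)] *[OF assms(2,1)]
    by (intro Hd_leI KR_hull assms) (simp_all add: dist_commute Hd_commute)
qed

section \<open>Continuity from Lipschitz bounds\<close>

lemma continuous_map_lipschitz:
  assumes "Metric_space M d" "Metric_space M' d'" and "\<And>x. x \<in> M \<Longrightarrow> h x \<in> M'"
    and L: "\<And>x y. x \<in> M \<Longrightarrow> y \<in> M \<Longrightarrow> d' (h x) (h y) \<le> L * d x y"
  shows "continuous_map (Metric_space.mtopology M d) (Metric_space.mtopology M' d') h"
proof -
  interpret Metric_space M d by fact
  have "\<exists>\<delta>>0. \<forall>y. y \<in> M \<and> d x y < \<delta> \<longrightarrow> d' (h x) (h y) < e" if "x \<in> M" "e > 0" for x e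
  proof (intro exI conjI allI impI)
    \<comment> \<open>\<open>L\<close> may have any sign; \<open>\<bar>L\<bar> + 1\<close> is a
      positive upper bound.\<close>
    show "0 < e / (\<bar>L\<bar> + 1)" using \<open>e > 0\<close> by simp
    fix y assume y: "y \<in> M \<and> d x y < e / (\<bar>L\<bar> + 1)"
    have "d' (h x) (h y) \<le> L * d x y" using L that y by blast
    also have "\<dots> \<le> (\<bar>L\<bar> + 1) * d x y" by (intro mult_right_mono) auto
    also have "\<dots> < e" using y by (simp add: field_simps)
    finally show "d' (h x) (h y) < e" .
  qed
  then show ?thesis
    unfolding metric_continuous_map[OF assms(2)] using assms(3) by auto
qed

lemma continuous_map_lipschitz_real:
  fixes h :: "'a \<Rightarrow> real"
  assumes "Metric_space M d" and "\<And>x y. x \<in> M \<Longrightarrow> y \<in> M \<Longrightarrow> \<bar>h x - h y\<bar> \<le> L * d x y"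
  shows "continuous_map (Metric_space.mtopology M d) euclideanreal h"
  using continuous_map_lipschitz[OF assms(1) Met_TC.Metric_space_axioms, of h L] assms(2)
  by (simp add: dist_real_def)

section \<open>The system on the graph space\<close>

locale fractal_ifs =
  fixes t :: "nat \<Rightarrow> real" and tinf :: real
    and \<zeta> :: "nat \<Rightarrow> real \<Rightarrow> real" and a :: "nat \<Rightarrow> real" and \<alpha> :: real
    and B \<Phi> f :: "real \<Rightarrow> real set"
  assumes t_mono: "strict_mono_on {1..} t" and t_lim: "t \<longlonglongrightarrow> tinf"
    and \<zeta>: "interp_maps t tinf \<zeta> a"
    and \<alpha>: "\<bar>\<alpha>\<bar> < 1"
    and B: "\<And>s. s \<in> {t 1..tinf} \<Longrightarrow> B s \<in> KcR"
    and \<Phi>: "\<And>s. s \<in> {t 1..tinf} \<Longrightarrow> \<Phi> s \<in> KcR"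
    and f: "is_fractal_fun t tinf \<zeta> \<alpha> \<Phi> B f"
begin

abbreviation "I \<equiv> {t 1..tinf}"

section \<open>Nodes and cells\<close>

lemma t_less: "1 \<le> m \<Longrightarrow> m < n \<Longrightarrow> t m < t n"
  using t_mono by (auto simp: strict_mono_on_def)

lemma t_less_tinf: 
  assumes "1 \<le> n"
  shows "t n < tinf"
proof -
  have "t (Suc n) \<le> t m" if "Suc n \<le> m" for m
    using t_less[of "Suc n" m] that by (cases "m = Suc n") auto
  then have "t (Suc n) \<le> tinf"
    by (intro LIMSEQ_le_const[OF t_lim] exI[of _ "Suc n"]) simp
  then show ?thesis using t_less[of n "Suc n"] assms by simp
qed

lemma t_in_I: "1 \<le> n \<Longrightarrow> t n \<in> I"
  using t_less_tinf[of n] t_less[of 1 n] by (cases "n = 1") auto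

lemma \<zeta>_image: "1 \<le> i \<Longrightarrow> \<zeta> i ` I = {t i..t (Suc i)}"
  using \<zeta> by (auto simp: interp_maps_def homeomorphism_def)

lemma \<zeta>_inv: "1 \<le> i \<Longrightarrow> s \<in> I \<Longrightarrow> inv_into I (\<zeta> i) (\<zeta> i s) = s"
  using \<zeta> by (auto simp: interp_maps_def homeomorphism_def)

lemma \<zeta>_lipschitz: "1 \<le> i \<Longrightarrow> (a i)-lipschitz_on I (\<zeta> i)"
  using \<zeta> by (simp add: interp_maps_def)

lemma ratio_less_1: "1 \<le> i \<Longrightarrow> a i < 1"
  using \<zeta> by (simp add: interp_maps_def)

lemma ratio_nonneg: "1 \<le> i \<Longrightarrow> 0 \<le> a i"
  using \<zeta>_lipschitz lipschitz_on_nonneg by blast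

lemma \<zeta>_in_I: "1 \<le> i \<Longrightarrow> s \<in> I \<Longrightarrow> \<zeta> i s \<in> I"
proof -
  assume "1 \<le> i" "s \<in> I"
  then have "\<zeta> i s \<in> {t i..t (Suc i)}" using \<zeta>_image[of i] by blast
  then show "\<zeta> i s \<in> I" using t_in_I[OF \<open>1 \<le> i\<close>] t_in_I[of "Suc i"] by auto
qed

text \<open>\<open>tinf\<close> lies in no cell \<open>{t n..t (Suc n)}\<close>. Any other point is
  below some node, and induction on the index of that node finds a cell containing it.\<close>

lemma I_cover:
  assumes "s \<in> I" "s \<noteq> tinf"
  obtains i w where "1 \<le> i" "w \<in> I" "s = \<zeta> i w"
proof -
  have "s < tinf" using assms by auto
  then have "\<forall>\<^sub>F n in sequentially. s < t n \<and> 1 \<le> n"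
    using order_tendstoD(1)[OF t_lim] eventually_ge_at_top by (intro eventually_conj) auto
  then obtain n where "1 \<le> n" "s < t n"
    using eventually_happens'[OF sequentially_bot] by blast
  then have "\<exists>i\<ge>1. t i \<le> s \<and> s \<le> t (Suc i)"
  proof (induction n rule: dec_induct)
    case base
    then show ?case using assms by simp
  next
    case (step n)
    then show ?case by (cases "s < t n") (auto intro: less_imp_le)
  qed
  then obtain i where i: "i \<ge> 1" "s \<in> {t i..t (Suc i)}" by auto
  then obtain w where "w \<in> I" "s = \<zeta> i w" using \<zeta>_image[of i] by blast
  with i that show thesis by blast
qed

section \<open>The fractal function and the convexity of its values\<close>

lemma f_KR: "s \<in> I \<Longrightarrow> f s \<in> KR"
  and f_cont: "continuous_map (top_of_set I) KR_top f"
proof -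
  interpret Metric_space KR Hd by (rule Metric_space_KR)
  show c: "continuous_map (top_of_set I) KR_top f"
    using f by (simp add: is_fractal_fun_def Let_def)
  show "s \<in> I \<Longrightarrow> f s \<in> KR"
    using continuous_map_funspace[OF c] by (auto simp: Pi_iff)
qed

lemma f_self_affine:
  assumes "1 \<le> i" "s \<in> I"
  shows "f (\<zeta> i s) = \<Phi> (\<zeta> i s) + \<alpha> \<odot> (f s \<ominus> B s)"
proof -
  have "\<zeta> i s \<in> {t i..t (Suc i)}" using \<zeta>_image[of i] assms by blast
  then have "f (\<zeta> i s) = \<Phi> (\<zeta> i s) + \<alpha> \<odot> (f (inv_into I (\<zeta> i) (\<zeta> i s)) \<ominus> B (inv_into I (\<zeta> i) (\<zeta> i s)))"
    using f assms(1) by (simp add: is_fractal_fun_def Let_def)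
  then show ?thesis by (simp only: \<zeta>_inv[OF assms])
qed

text \<open>The distance \<open>q\<close> from a value to its convex hull is continuous along
  \<open>f\<close>, hence attains a maximum over \<open>I\<close>. Self-affinity with convex-valued
  \<open>\<Phi>\<close> and \<open>B\<close> shrinks it by \<open>\<bar>\<alpha>\<bar>\<close>, so
  the maximum is zero.\<close>

lemma f_KcR:
  assumes "s \<in> I"
  shows "f s \<in> KcR"
proof -
  interpret H: Metric_space KR Hd by (rule Metric_space_KR)
  define q where "q = (\<lambda>A. Hd A (convex hull A))"
  \<comment> \<open>Passing from \<open>A\<close> to \<open>C\<close> moves both the set and its
    hull by at most \<open>Hd A C\<close>, hence the factor 2.\<close>
  have "\<bar>q A - q C\<bar> \<le> 2 * Hd A C" if "A \<in> KR" "C \<in> KR" for A C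
    using Hd_hull_le[OF that] H.triangle[of A C "convex hull A"]
      H.triangle[of C "convex hull C" "convex hull A"]
      H.triangle[of C A "convex hull C"] H.triangle[of A "convex hull A" "convex hull C"]
      H.commute that KR_hull unfolding q_def by (smt (verit))
  then have "continuous_map KR_top euclideanreal q"
    by (rule continuous_map_lipschitz_real[OF Metric_space_KR])
  from continuous_map_compose[OF f_cont this] have cont: "continuous_on I (\<lambda>s. q (f s))"
    by (simp add: comp_def)
  then obtain m where m: "m \<in> I" "\<And>s. s \<in> I \<Longrightarrow> q (f s) \<le> q (f m)"
    using continuous_attains_sup[OF compact_Icc _ cont] assms by fastforce
  have shrink: "q (f (\<zeta> i w)) \<le> \<bar>\<alpha>\<bar> * q (f m)" if i: "1 \<le> i" and w: "w \<in> I" for i w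
  proof -
    have \<Phi>w: "\<Phi> (\<zeta> i w) \<in> KcR" and Bw: "B w \<in> KcR" and fw: "f w \<in> KR"
      using \<Phi> B f_KR \<zeta>_in_I[OF that] w by auto
    let ?E = "\<Phi> (\<zeta> i w) + (\<alpha> * -1) \<odot> B w"
    have E: "?E \<in> KcR" by (intro KcR_plus KcR_scale \<Phi>w Bw)
    have fz: "f (\<zeta> i w) = \<alpha> \<odot> f w + ?E"
      by (simp add: f_self_affine[OF that] mink_diff_eq mink_scale_plus mink_scale_scale ac_simps)
    \<comment> \<open>Convex hulls commute with scaling and Minkowski sums, and the convex set
      \<open>?E\<close> is its own hull; the common summand then drops out of the estimate.\<close>
    have "convex hull (f (\<zeta> i w)) = \<alpha> \<odot> (convex hull f w) + ?E"
      unfolding fz mink_scale_image[of \<alpha>] convex_hull_set_plus[of "(\<lambda>x. \<alpha> *\<^sub>R x) ` f w" ?E] convex_hull_scaling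
      using E by (simp only: KcR_iff convex_hull_eq[symmetric])
    then have "q (f (\<zeta> i w)) = Hd (\<alpha> \<odot> f w + ?E) (\<alpha> \<odot> (convex hull f w) + ?E)"
      by (simp add: q_def fz)
    also have "\<dots> \<le> Hd (\<alpha> \<odot> f w) (\<alpha> \<odot> (convex hull f w))"
      using E by (intro Hd_plus_le KR_scale KR_hull fw) (simp add: KcR_iff)
    also have "\<dots> \<le> \<bar>\<alpha>\<bar> * q (f w)"
      unfolding q_def by (intro Hd_scale_le KR_hull fw)
    also have "\<dots> \<le> \<bar>\<alpha>\<bar> * q (f m)"
      using m w by (intro mult_left_mono) auto
    finally show ?thesis .
  qed
  have q_t: "q (f (t n)) \<le> \<bar>\<alpha>\<bar> * q (f m)" if "1 \<le> n" for n
  proof -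
    have "t n \<in> I" "t n \<noteq> tinf" using t_in_I[OF that] t_less_tinf[OF that] by simp_all
    then obtain i w where "1 \<le> i" "w \<in> I" "t n = \<zeta> i w"
      by (rule I_cover)
    then show ?thesis using shrink by simp
  qed
  \<comment> \<open>No cell contains \<open>tinf\<close>, so the bound is carried there from the
    nodes by continuity.\<close>
  have "q (f tinf) \<le> \<bar>\<alpha>\<bar> * q (f m)"
  proof (rule LIMSEQ_le_const2)
    show "(\<lambda>n. q (f (t n))) \<longlonglongrightarrow> q (f tinf)"
      by (rule continuous_on_tendsto_compose[OF cont t_lim])
        (use t_in_I t_less_tinf[of 1] in \<open>auto simp: eventually_sequentially intro!: exI[of _ 1]\<close>)
    show "\<exists>N. \<forall>n\<ge>N. q (f (t n)) \<le> \<bar>\<alpha>\<bar> * q (f m)" using q_t by blast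
  qed
  moreover have "q (f m) \<le> \<bar>\<alpha>\<bar> * q (f m)" if "m \<noteq> tinf"
    using I_cover[OF m(1) that] shrink by metis
  ultimately have "q (f m) \<le> \<bar>\<alpha>\<bar> * q (f m)" by fastforce
  then have "(1 - \<bar>\<alpha>\<bar>) * q (f m) \<le> 0" by (simp add: algebra_simps)
  then have "q (f m) \<le> 0" using \<alpha> by (simp add: mult_le_0_iff)
  then have "q (f s) \<le> 0" using m(2)[OF assms] by linarith
  then have "q (f s) = 0" unfolding q_def using H.nonneg by (rule order.antisym)
  then have "f s = convex hull f s" unfolding q_def using H.zero f_KR[OF assms] KR_hull by blast
  then show ?thesis
    using f_KR[OF assms] convex_convex_hull[of "f s"] by (simp add: KcR_iff)
qed

section \<open>The metric \<open>D\<close> and the maps \<open>G i\<close>\<close>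

abbreviation "D \<equiv> graph_dist f"
abbreviation "X \<equiv> I \<times> KcR"
abbreviation "T \<equiv> graph_top t tinf f"
abbreviation "G \<equiv> ifs_map \<zeta> \<alpha> \<Phi> B"

lemma Metric_space_X: "Metric_space X D"
  by (rule Metric_space_graph_dist) (rule f_KcR)

sublocale X: Metric_space X D
  rewrites "Metric_space.mtopology X D = T"
  using Metric_space_X by (simp_all add: graph_top_def)

lemma G_eq: "G i (s, S) = (\<zeta> i s, \<alpha> \<odot> S + (\<Phi> (\<zeta> i s) + (\<alpha> * -1) \<odot> B s))"
  by (simp add: ifs_map_def mink_diff_eq mink_scale_scale ac_simps)

text \<open>The self-affine equation in the shape of \<open>G_eq\<close>, with the same translation
  summand; hence the graph is invariant.\<close>

lemma f_eq: "1 \<le> i \<Longrightarrow> s \<in> I \<Longrightarrow> f (\<zeta> i s) = \<alpha> \<odot> f s + (\<Phi> (\<zeta> i s) + (\<alpha> * -1) \<odot> B s)"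
  by (simp add: f_self_affine mink_diff_eq mink_scale_plus mink_scale_scale ac_simps)

lemma G_graph: "1 \<le> i \<Longrightarrow> s \<in> I \<Longrightarrow> G i (s, f s) = (\<zeta> i s, f (\<zeta> i s))"
  by (simp add: G_eq f_eq)

lemma translation_KcR: "1 \<le> i \<Longrightarrow> s \<in> I \<Longrightarrow> \<Phi> (\<zeta> i s) + (\<alpha> * -1) \<odot> B s \<in> KcR"
  by (intro KcR_plus KcR_scale \<Phi> B \<zeta>_in_I)

lemma G_in_X: "1 \<le> i \<Longrightarrow> x \<in> X \<Longrightarrow> G i x \<in> X"
  using translation_KcR[of i "fst x"] \<zeta>_in_I[of i "fst x"]
  by (cases x) (auto simp: G_eq intro!: KcR_plus KcR_scale)

text \<open>In the metric \<open>D\<close> the vertical contraction ratio is \<open>\<bar>\<alpha>\<bar>\<close> even between points over different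
  abscissae: the cross terms turn the translation part of \<open>G i\<close> into one common summand.\<close>

lemma Hd_G_le:
  assumes i: "1 \<le> i" and x: "(s, S) \<in> X" and y: "(w, W) \<in> X"
  shows "Hd (snd (G i (s, S)) + f (\<zeta> i w)) (snd (G i (w, W)) + f (\<zeta> i s))
           \<le> \<bar>\<alpha>\<bar> * Hd (S + f w) (W + f s)"
proof -
  have sw: "s \<in> I" "w \<in> I" "S \<in> KR" "W \<in> KR" "f s \<in> KR" "f w \<in> KR"
    using x y f_KR KcR_subset_KR by auto
  let ?e = "\<lambda>s. \<Phi> (\<zeta> i s) + (\<alpha> * -1) \<odot> B s"
  have "?e s \<in> KcR" "?e w \<in> KcR"
    using translation_KcR[OF i] sw by simp_all
  then have e: "?e s + ?e w \<in> KR"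
    using KR_plus KcR_subset_KR by blast
  have "Hd (snd (G i (s, S)) + f (\<zeta> i w)) (snd (G i (w, W)) + f (\<zeta> i s))
      = Hd (\<alpha> \<odot> (S + f w) + (?e s + ?e w)) (\<alpha> \<odot> (W + f s) + (?e s + ?e w))"
    using i sw by (simp add: G_eq f_eq mink_scale_plus ac_simps)
  also have "\<dots> \<le> Hd (\<alpha> \<odot> (S + f w)) (\<alpha> \<odot> (W + f s))"
    using e sw by (intro Hd_plus_le) (simp_all add: KR_scale KR_plus)
  also have "\<dots> \<le> \<bar>\<alpha>\<bar> * Hd (S + f w) (W + f s)"
    using sw by (intro Hd_scale_le KR_plus)
  finally show ?thesis .
qed

lemma fst_G: "fst (G i x) = \<zeta> i (fst x)"
  by (cases x) (simp add: G_eq)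

lemma D_G_le:
  assumes i: "1 \<le> i" and x: "x \<in> X" and y: "y \<in> X"
  shows "D (G i x) (G i y) \<le> 1 * D x y"
proof -
  obtain s S w W where xy: "x = (s, S)" "y = (w, W)" by fastforce
  have "\<bar>\<zeta> i s - \<zeta> i w\<bar> \<le> a i * \<bar>s - w\<bar>"
    using lipschitz_onD[OF \<zeta>_lipschitz[OF i], of s w] x y xy by (auto simp: dist_real_def)
  also have "\<dots> \<le> \<bar>s - w\<bar>"
    using ratio_less_1[OF i] by (intro mult_left_le_one_le) (auto simp: ratio_nonneg[OF i])
  finally have 1: "\<bar>\<zeta> i s - \<zeta> i w\<bar> \<le> \<bar>s - w\<bar>" .
  have "\<bar>\<alpha>\<bar> * Hd (S + f w) (W + f s) \<le> Hd (S + f w) (W + f s)"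
    using \<alpha> Metric_space.nonneg[OF Metric_space_KR] by (intro mult_left_le_one_le) auto
  then have 2: "Hd (snd (G i (s, S)) + f (\<zeta> i w)) (snd (G i (w, W)) + f (\<zeta> i s)) \<le> Hd (S + f w) (W + f s)"
    using Hd_G_le[OF i] x y xy by (meson order.trans)
  show ?thesis
    using add_mono[OF 1 2] by (simp add: xy graph_dist_def case_prod_unfold fst_G)
qed

lemma continuous_map_G: "1 \<le> i \<Longrightarrow> continuous_map T T (G i)"
  unfolding graph_top_def
  using continuous_map_lipschitz[OF Metric_space_X Metric_space_X G_in_X D_G_le] by blast

text \<open>For graph points both crossed sums equal \<open>f s + f w\<close>, so the Hausdorff term
  vanishes.\<close>

lemma D_graph: "s \<in> I \<Longrightarrow> w \<in> I \<Longrightarrow> D (s, f s) (w, f w) = \<bar>s - w\<bar>"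
  using Metric_space.mdist_zero[OF Metric_space_KR, of "f s + f w"] f_KR KR_plus
  by (simp add: graph_dist_def add.commute)

lemma continuous_map_fst: "continuous_map T euclideanreal fst"
  unfolding graph_top_def
proof (rule continuous_map_lipschitz_real[OF Metric_space_X])
  show "\<bar>fst x - fst y\<bar> \<le> 1 * D x y" for x y
    using Metric_space.nonneg[OF Metric_space_KR] by (simp add: graph_dist_def case_prod_unfold)
qed

section \<open>Vertical distance to the graph; parametrisation of the graph\<close>

definition gap :: "real \<times> real set \<Rightarrow> real" where
  "gap x = D x (fst x, f (fst x))"

lemma gap_nonneg: "0 \<le> gap x"
  by (simp add: gap_def)

lemma gap_eq_0_iff: "x \<in> X \<Longrightarrow> gap x = 0 \<longleftrightarrow> x = (fst x, f (fst x))"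
  using X.zero[of x "(fst x, f (fst x))"] f_KcR by (auto simp: gap_def)

text \<open>\<open>Hd_G_le\<close> with the second point on the graph: by \<open>G_graph\<close> its
  image is the graph point above the new abscissa.\<close>

lemma gap_G_le:
  assumes i: "1 \<le> i" and x: "x \<in> X"
  shows "gap (G i x) \<le> \<bar>\<alpha>\<bar> * gap x"
proof -
  obtain s S where x': "x = (s, S)" "(s, S) \<in> X" "(s, f s) \<in> X" using x f_KcR by auto
  show ?thesis
    using Hd_G_le[OF i x'(2,3)] G_graph[OF i, of s] x'
    by (simp add: gap_def graph_dist_def case_prod_unfold fst_G)
qed

text \<open>The foot points satisfy \<open>D ?x ?y \<le> D x y\<close> by \<open>D_graph\<close>;
  moving the point and moving its foot each cost at most \<open>D x y\<close>.\<close>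

lemma continuous_map_gap: "continuous_map T euclideanreal gap"
  unfolding graph_top_def
proof (rule continuous_map_lipschitz_real[OF Metric_space_X])
  fix x y assume xy: "x \<in> X" "y \<in> X"
  let ?x = "(fst x, f (fst x))" and ?y = "(fst y, f (fst y))"
  have X: "?x \<in> X" "?y \<in> X" using xy f_KcR by auto
  have "D ?x ?y \<le> D x y"
    using xy Metric_space.nonneg[OF Metric_space_KR]
    by (subst D_graph) (auto simp: graph_dist_def)
  then show "\<bar>gap x - gap y\<bar> \<le> 2 * D x y"
    unfolding gap_def using X.triangle[of x y ?x] X.triangle[of y ?y ?x] X.triangle[of y x ?y]
      X.triangle[of x ?x ?y] X.commute xy X by (smt (verit))
qed

text \<open>Clamping extends the parametrisation to the whole line, so that measures on
  \<open>borel\<close> can be pushed forward; it is constant on either side of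
  \<open>I\<close>.\<close>

definition graph_point :: "real \<Rightarrow> real \<times> real set" where
  "graph_point s = (clamp (t 1) tinf s, f (clamp (t 1) tinf s))"

lemma clamp_in_I: "clamp (t 1) tinf s \<in> I"
  using clamp_in_interval[of "t 1" tinf s] t_less_tinf[of 1] by (simp add: cbox_interval)

lemma clamp_on_I: "s \<in> I \<Longrightarrow> clamp (t 1) tinf s = s"
  using clamp_cancel_cbox[of s "t 1" tinf] by (simp add: cbox_interval)

lemma graph_point_in_X: "graph_point s \<in> X"
  using clamp_in_I f_KcR by (simp add: graph_point_def)

lemma graph_point_on_I: "s \<in> I \<Longrightarrow> graph_point s = (s, f s)"
  by (simp add: graph_point_def clamp_on_I)

lemma continuous_map_graph_point: "continuous_map euclideanreal T graph_point"
proof -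
  have "D (graph_point s) (graph_point w) \<le> 1 * dist s w" for s w
    using dist_clamps_le_dist_args[of "t 1" tinf s w] clamp_in_I
    by (simp add: graph_point_def D_graph dist_real_def)
  then show ?thesis
    using continuous_map_lipschitz[OF Met_TC.Metric_space_axioms Metric_space_X,
        where h = graph_point and L = 1] graph_point_in_X
    by (simp add: graph_top_def)
qed

lemma gap_graph_point: "gap (graph_point s) = 0"
  using gap_eq_0_iff[OF graph_point_in_X, of s] by (simp add: graph_point_def)

end

section \<open>Invariant measures\<close>

lemma space_borel_of_top: "space (borel_of_top T) = topspace T"
  by (simp add: borel_of_top_def space_measure_of_conv)

lemma sets_borel_of_top: "sets (borel_of_top T) = sigma_sets (topspace T) {U. openin T U}"
  unfolding borel_of_top_def by (rule sets_measure_of) (auto dest: openin_subset)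

lemma openin_borel_of_top: "openin T U \<Longrightarrow> U \<in> sets (borel_of_top T)"
  by (auto simp: sets_borel_of_top)

lemma measurable_borel_of_top:
  assumes "continuous_map S T h"
  shows "h \<in> borel_of_top S \<rightarrow>\<^sub>M borel_of_top T"
  unfolding borel_of_top_def[of T]
proof (rule measurable_measure_of)
  show "{U. openin T U} \<subseteq> Pow (topspace T)" by (auto dest: openin_subset)
  show "h \<in> space (borel_of_top S) \<rightarrow> topspace T"
    using continuous_map_funspace[OF assms] by (simp add: space_borel_of_top)
  fix U assume "U \<in> {U. openin T U}"
  then have "openin S {x \<in> topspace S. h x \<in> U}"
    using assms by (simp add: continuous_map_def)
  then show "h -` U \<inter> space (borel_of_top S) \<in> sets (borel_of_top S)"
    by (simp add: openin_borel_of_top space_borel_of_top vimage_def Collect_conj_eq Int_commute)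
qed

text \<open>By the semiconjugacy, pulling a set back along \<open>g' i\<close> and then
  \<open>h\<close> is the same as along \<open>h\<close> and then \<open>g i\<close>. Used in both
  directions, with \<open>graph_point\<close> and with \<open>fst\<close>.\<close>

lemma invariant_prob_distr:
  assumes \<mu>: "invariant_prob S g p \<mu>" and h: "continuous_map S T h"
    and g: "\<And>i x. i \<ge> 1 \<Longrightarrow> x \<in> topspace S \<Longrightarrow> g i x \<in> topspace S"
    and g': "\<And>i. i \<ge> 1 \<Longrightarrow> continuous_map T T (g' i)"
    and semiconj: "\<And>i x. i \<ge> 1 \<Longrightarrow> x \<in> topspace S \<Longrightarrow> h (g i x) = g' i (h x)"
  shows "invariant_prob T g' p (distr \<mu> (borel_of_top T) h)"
proof -
  have sp: "space \<mu> = topspace S" and se: "sets \<mu> = sets (borel_of_top S)"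
    and sum: "\<And>A. A \<in> sets \<mu> \<Longrightarrow>
      ((\<lambda>i. p i * measure \<mu> (g i -` A \<inter> space \<mu>)) has_sum measure \<mu> A) {1..}"
    and prob: "prob_space \<mu>"
    using \<mu> by (auto simp: invariant_prob_def)
  have hm: "h \<in> \<mu> \<rightarrow>\<^sub>M borel_of_top T"
    using measurable_borel_of_top[OF h] measurable_cong_sets[OF se refl] by blast
  have hT: "h x \<in> topspace T" if "x \<in> topspace S" for x
    using continuous_map_funspace[OF h] that by (auto simp: Pi_iff)
  have "((\<lambda>i. p i * measure (distr \<mu> (borel_of_top T) h) (g' i -` A \<inter> topspace T)) has_sum
      measure (distr \<mu> (borel_of_top T) h) A) {1..}" if A: "A \<in> sets (borel_of_top T)" for A
  proof -
    have "measure (distr \<mu> (borel_of_top T) h) (g' i -` A \<inter> topspace T)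
        = measure \<mu> (g i -` (h -` A \<inter> space \<mu>) \<inter> space \<mu>)" if i: "i \<ge> 1" for i
    proof -
      have "g' i -` A \<inter> topspace T \<in> sets (borel_of_top T)"
        using measurable_sets[OF measurable_borel_of_top[OF g'[OF i]] A] by (simp add: space_borel_of_top)
      then have "measure (distr \<mu> (borel_of_top T) h) (g' i -` A \<inter> topspace T)
          = measure \<mu> (h -` (g' i -` A \<inter> topspace T) \<inter> space \<mu>)"
        by (rule measure_distr[OF hm])
      also have "h -` (g' i -` A \<inter> topspace T) \<inter> space \<mu> = g i -` (h -` A \<inter> space \<mu>) \<inter> space \<mu>"
        using hT g[OF i] semiconj[OF i] by (auto simp: sp)
      finally show ?thesis .
    qed
    then show ?thesis
      using sum[OF measurable_sets[OF hm A]] measure_distr[OF hm A]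
      by (subst has_sum_cong) auto
  qed
  then show ?thesis
    using prob_space.prob_space_distr[OF prob hm] by (simp add: invariant_prob_def space_borel_of_top)
qed

text \<open>As \<open>r\<close> may fail to be integrable, its sublevel sets are compared: each has
  at most the mass of the one with level scaled by \<open>c\<close>, and enlarging repeatedly
  exhausts the space.\<close>

lemma invariant_prob_AE_zero:
  assumes \<mu>: "invariant_prob T g p \<mu>"
    and g: "\<And>i. i \<ge> 1 \<Longrightarrow> continuous_map T T (g i)"
    and p0: "\<And>i. i \<ge> 1 \<Longrightarrow> 0 \<le> p i" and p1: "(p has_sum 1) {1..}"
    and r: "continuous_map T euclideanreal r" and r0: "\<And>x. 0 \<le> r x"
    and le: "\<And>i x. i \<ge> 1 \<Longrightarrow> x \<in> topspace T \<Longrightarrow> r (g i x) \<le> c * r x"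
    and c: "0 \<le> c" "c < 1"
  shows "AE x in \<mu>. r x = 0"
proof -
  have sp: "space \<mu> = topspace T" and se: "sets \<mu> = sets (borel_of_top T)"
    and sum: "\<And>A. A \<in> sets \<mu> \<Longrightarrow>
      ((\<lambda>i. p i * measure \<mu> (g i -` A \<inter> space \<mu>)) has_sum measure \<mu> A) {1..}"
    using \<mu> by (auto simp: invariant_prob_def)
  interpret prob_space \<mu> using \<mu> by (simp add: invariant_prob_def)
  have [measurable]: "r \<in> borel_measurable \<mu>"
    using measurable_borel_of_top[OF r]
    by (simp add: borel_of_top_euclidean measurable_cong_sets[OF se refl])
  \<comment> \<open>The sublevel set \<open>r x \<le> 1 / b\<close>, in product form so that
    \<open>b = 0\<close> gives the whole space.\<close>
  define E where "E b = {x \<in> space \<mu>. b * r x \<le> 1}" for b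
  have E [measurable]: "E b \<in> sets \<mu>" for b unfolding E_def by measurable
  \<comment> \<open>Every \<open>g i\<close> maps \<open>E (b * c)\<close> into \<open>E b\<close>;
    summing with the weights gives the comparison.\<close>
  have step: "prob (E (b * c)) \<le> prob (E b)" if "0 \<le> b" for b
  proof (rule has_sum_mono)
    show "((\<lambda>i. p i * prob (E (b * c))) has_sum prob (E (b * c))) {1..}"
      using has_sum_cmult_left[OF p1, of "prob (E (b * c))"] by simp
    show "((\<lambda>i. p i * prob (g i -` E b \<inter> space \<mu>)) has_sum prob (E b)) {1..}"
      by (rule sum) (rule E)
    fix i :: nat assume "i \<in> {1..}"
    then have i: "i \<ge> 1" by simp
    have gm: "g i \<in> \<mu> \<rightarrow>\<^sub>M \<mu>"
      using measurable_borel_of_top[OF g[OF i]] measurable_cong_sets[OF se se] by blast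
    have "E (b * c) \<subseteq> g i -` E b \<inter> space \<mu>"
    proof
      fix x assume x: "x \<in> E (b * c)"
      then have "b * r (g i x) \<le> b * (c * r x)"
        using le[OF i] \<open>0 \<le> b\<close> by (intro mult_left_mono) (auto simp: E_def sp)
      then show "x \<in> g i -` E b \<inter> space \<mu>"
        using x measurable_space[OF gm] by (auto simp: E_def mult.assoc)
    qed
    then show "p i * prob (E (b * c)) \<le> p i * prob (g i -` E b \<inter> space \<mu>)"
      using p0[OF i] measurable_sets[OF gm E] by (intro mult_left_mono finite_measure_mono)
  qed
  have "prob (E b) = 1" if b: "0 \<le> b" for b
  proof -
    have iter: "prob (E (b * c ^ n)) \<le> prob (E b)" for n
    proof (induction n)
      case (Suc n)
      then show ?case using step[of "b * c ^ n"] b c by (simp add: mult_ac)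
    qed simp
    have "incseq (\<lambda>n. E (b * c ^ n))"
    proof (rule incseq_SucI, rule subsetI)
      fix n x assume x: "x \<in> E (b * c ^ n)"
      have "b * c ^ Suc n * r x \<le> b * c ^ n * r x"
        using b c r0[of x] by (intro mult_right_mono mult_left_mono) (auto intro!: mult_left_le_one_le)
      then show "x \<in> E (b * c ^ Suc n)" using x by (auto simp: E_def)
    qed
    then have "(\<lambda>n. prob (E (b * c ^ n))) \<longlonglongrightarrow> prob (\<Union>n. E (b * c ^ n))"
      using E by (intro finite_Lim_measure_incseq) auto
    moreover have "(\<Union>n. E (b * c ^ n)) = space \<mu>"
    proof -
      have "\<exists>n. x \<in> E (b * c ^ n)" if "x \<in> space \<mu>" for x
      proof -
        have "(\<lambda>n. b * c ^ n * r x) \<longlonglongrightarrow> b * 0 * r x"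
          by (intro tendsto_intros LIMSEQ_realpow_zero c)
        then have "\<forall>\<^sub>F n in sequentially. b * c ^ n * r x < 1"
          by (rule order_tendstoD) simp
        then obtain n where "b * c ^ n * r x < 1"
          using eventually_happens'[OF sequentially_bot] by blast
        then show ?thesis using that by (auto simp: E_def intro!: exI[of _ n])
      qed
      then show ?thesis by (auto simp: E_def)
    qed
    ultimately have "(\<lambda>n. prob (E (b * c ^ n))) \<longlonglongrightarrow> 1"
      by (simp add: prob_space)
    then have "1 \<le> prob (E b)" using iter by (intro LIMSEQ_le_const2) auto
    then show ?thesis using prob_le_1[of "E b"] by simp
  qed
  then have "AE x in \<mu>. x \<in> E (real n)" for n
    by (intro iffD1[OF prob_eq_1] E) simp
  then have "AE x in \<mu>. \<forall>n. real n * r x \<le> 1"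
    unfolding AE_all_countable by (auto simp: E_def elim!: eventually_mono)
  then show ?thesis
  proof (eventually_elim)
    case (elim x)
    show "r x = 0"
    proof (rule ccontr)
      assume "r x \<noteq> 0"
      then have "0 < r x" using r0[of x] by simp
      then obtain n where "1 < real n * r x" using ex_less_of_nat_mult by blast
      then show False using elim by (simp add: not_le[symmetric])
    qed
  qed
qed

section \<open>Invariant measures on the line and on the graph space\<close>

context fractal_ifs
begin

text \<open>\<open>\<zeta> i\<close> extended to the line by clamping its argument, which keeps the
  Lipschitz constant, to fit \<open>invariant_prob_real_unique\<close>.\<close>

definition Z :: "nat \<Rightarrow> real \<Rightarrow> real" where
  "Z i s = \<zeta> i (clamp (t 1) tinf s)"

lemma Z_in_I: "1 \<le> i \<Longrightarrow> Z i s \<in> I"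
  unfolding Z_def by (intro \<zeta>_in_I clamp_in_I)

lemma Z_lipschitz:
  assumes "1 \<le> i"
  shows "(a i)-lipschitz_on UNIV (Z i)"
proof (rule lipschitz_onI)
  fix s w
  have "dist (Z i s) (Z i w) \<le> a i * dist (clamp (t 1) tinf s) (clamp (t 1) tinf w)"
    unfolding Z_def by (intro lipschitz_onD[OF \<zeta>_lipschitz[OF assms]] clamp_in_I)
  also have "\<dots> \<le> a i * dist s w"
    by (intro mult_left_mono dist_clamps_le_dist_args ratio_nonneg assms)
  finally show "dist (Z i s) (Z i w) \<le> a i * dist s w" .
qed (rule ratio_nonneg[OF assms])

lemma continuous_Z: "1 \<le> i \<Longrightarrow> continuous_on UNIV (Z i)"
  using Z_lipschitz lipschitz_on_continuous_on by blast

lemma graph_point_Z: "1 \<le> i \<Longrightarrow> graph_point (Z i s) = G i (graph_point s)"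
  using clamp_in_I[of s] Z_in_I[of i s] by (simp add: graph_point_on_I G_graph Z_def graph_point_def)

lemma fst_G_Z: "x \<in> X \<Longrightarrow> fst (G i x) = Z i (fst x)"
  by (auto simp: fst_G Z_def clamp_on_I)

lemma full_support_real:
  assumes \<nu>: "invariant_prob euclidean Z p \<nu>"
    and p0: "\<And>i. i \<ge> 1 \<Longrightarrow> 0 < p i" and p1: "(p has_sum 1) {1..}"
    and s: "s \<in> I" "open V" "s \<in> V"
  shows "0 < measure \<nu> V"
proof -
  have sp: "space \<nu> = UNIV" and se [measurable_cong, simp]: "sets \<nu> = sets borel"
    and sum: "\<And>A. A \<in> sets borel \<Longrightarrow> ((\<lambda>i. p i * measure \<nu> (Z i -` A)) has_sum measure \<nu> A) {1..}"
    using \<nu> by (auto simp: invariant_prob_def borel_of_top_euclidean)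
  interpret prob_space \<nu> using \<nu> by (simp add: invariant_prob_def)
  have p0': "0 \<le> p i" if "i \<ge> 1" for i using p0[OF that] by simp
  \<comment> \<open>The support of \<open>\<nu>\<close> within \<open>I\<close>, obtained by
    removing all open null sets.\<close>
  define K where "K = I - \<Union>{V. open V \<and> prob V = 0}"
  have "closed K" unfolding K_def by (intro closed_Diff open_Union) auto
  have KI: "K \<subseteq> I" by (auto simp: K_def)
  have K_pos: "0 < prob V" if "k \<in> K" "open V" "k \<in> V" for k V
    using that by (auto simp: K_def zero_less_measure_iff)
  \<comment> \<open>All values of \<open>Z i\<close> lie in \<open>I\<close>, so the invariance sum
    for \<open>I\<close> is the sum of the weights.\<close>
  have "Z i -` I = UNIV" if "i \<ge> 1" for i using Z_in_I[OF that] by auto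
  then have sum_I: "((\<lambda>i. p i * prob (Z i -` I)) has_sum 1) {1..}"
    using p1 prob_space by (subst has_sum_cong[of _ _ p]) (auto simp: sp)
  have prob_I: "prob I = 1"
    by (rule has_sum_unique[OF sum sum_I]) simp
  have "K \<noteq> {}"
  proof
    assume "K = {}"
    \<comment> \<open>By compactness finitely many open null sets would cover \<open>I\<close>,
      contrary to \<open>prob I = 1\<close>.\<close>
    then have cover: "I \<subseteq> \<Union>{V. open V \<and> prob V = 0}" by (auto simp: K_def)
    obtain C where C: "C \<subseteq> {V. open V \<and> prob V = 0}" "finite C" "I \<subseteq> \<Union>C"
      by (rule compactE[OF compact_Icc cover]) blast+
    then have "open (\<Union>V\<in>C. V)" by (intro open_UN) blast
    then have "prob I \<le> prob (\<Union>V\<in>C. V)"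
      using C by (intro finite_measure_mono) auto
    also have "\<dots> \<le> (\<Sum>V\<in>C. prob V)"
      using C by (intro finite_measure_subadditive_finite) auto
    also have "\<dots> = 0" using C by (intro sum.neutral) auto
    finally show False using prob_I by simp
  qed
  have Z_K: "Z i k \<in> K" if i: "1 \<le> i" and k: "k \<in> K" for i k
  proof -
    \<comment> \<open>A single term of the invariance sum is a lower bound for
      \<open>prob V\<close>, and its weight \<open>p i\<close> is positive.\<close>
    have "0 < prob V" if V: "open V" "Z i k \<in> V" for V
    proof -
      have "open (Z i -` V)" using continuous_Z[OF i] V(1) by (simp add: continuous_on_open_vimage)
      then have "0 < prob (Z i -` V)" using K_pos[OF k] V(2) by auto
      moreover have "p i * prob (Z i -` V) \<le> prob V"
      proof -
        have "((\<lambda>j. p j * prob (Z j -` V)) has_sum p i * prob (Z i -` V)) {i}"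
          using has_sum_finite[of "{i}" "\<lambda>j. p j * prob (Z j -` V)"] by simp
        then show ?thesis
          by (rule has_sum_mono_neutral[OF _ sum[of V]]) (use V i p0' in auto)
      qed
      ultimately show ?thesis using p0[OF i] by (smt (verit) mult_pos_pos)
    qed
    then show ?thesis using Z_in_I[OF i] by (fastforce simp: K_def)
  qed
  have tinf_K: "tinf \<in> K"
  proof -
    obtain k where k: "k \<in> K" using \<open>K \<noteq> {}\<close> by blast
    \<comment> \<open>The images of one point under successive maps stay in \<open>K\<close> and are
      squeezed towards \<open>tinf\<close> by the nodes.\<close>
    have "(\<lambda>n. Z (Suc n) k) \<longlonglongrightarrow> tinf"
    proof (rule tendsto_sandwich)
      have Z: "Z (Suc n) k \<in> {t (Suc n)..t (Suc (Suc n))}" for n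
        using \<zeta>_image[of "Suc n"] clamp_in_I[of k] by (auto simp: Z_def)
      show "\<forall>\<^sub>F n in sequentially. t (Suc n) \<le> Z (Suc n) k" using Z by simp
      show "\<forall>\<^sub>F n in sequentially. Z (Suc n) k \<le> t (Suc (Suc n))" using Z by simp
      show "(\<lambda>n. t (Suc n)) \<longlonglongrightarrow> tinf" by (rule LIMSEQ_Suc[OF t_lim])
      then show "(\<lambda>n. t (Suc (Suc n))) \<longlonglongrightarrow> tinf" by (rule LIMSEQ_Suc)
    qed
    then show ?thesis
      using closed_sequentially[OF \<open>closed K\<close>, of "\<lambda>n. Z (Suc n) k"] Z_K[OF _ k] by auto
  qed
  have "continuous_on I (\<lambda>w. infdist w K)" by (intro continuous_intros)
  then obtain m where m: "m \<in> I" "\<And>w. w \<in> I \<Longrightarrow> infdist w K \<le> infdist m K"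
    using continuous_attains_sup[OF compact_Icc, of "t 1" tinf "\<lambda>w. infdist w K"] s(1) by fastforce
  have "infdist m K = 0"
  proof (cases "m = tinf")
    case False
    then obtain i w where i: "1 \<le> i" and w: "w \<in> I" "m = \<zeta> i w"
      by (rule I_cover[OF m(1)])
    obtain k where k: "k \<in> K" "infdist w K = dist w k"
      using infdist_attains_inf[OF \<open>closed K\<close> \<open>K \<noteq> {}\<close>] by blast
    have "infdist m K \<le> dist (Z i w) (Z i k)"
      using infdist_le[OF Z_K[OF i k(1)]] w by (simp add: Z_def clamp_on_I)
    also have "\<dots> \<le> a i * infdist w K"
      unfolding k(2) by (rule lipschitz_onD[OF Z_lipschitz[OF i]]) auto
    also have "\<dots> \<le> a i * infdist m K"
      using m(2)[OF w(1)] by (intro mult_left_mono ratio_nonneg i)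
    finally have "(1 - a i) * infdist m K \<le> 0" by (simp add: algebra_simps)
    then show ?thesis
      using ratio_less_1[OF i] infdist_nonneg[of m K] by (simp add: mult_le_0_iff)
  qed (use tinf_K in simp)
  then have "infdist s K = 0" using m(2)[OF s(1)] infdist_nonneg[of s K] by simp
  then have "s \<in> K" using in_closed_iff_infdist_zero[OF \<open>closed K\<close> \<open>K \<noteq> {}\<close>] by simp
  then show ?thesis using K_pos s by blast
qed

text \<open>Pushing the measure on the line forward along \<open>graph_point\<close> gives an
  invariant measure. Conversely, any invariant measure projects to the one on the line and, being
  carried by the graph, is recovered from its projection.\<close>

lemma unique_invariant_prob:
  assumes p0: "\<And>i. i \<ge> 1 \<Longrightarrow> 0 < p i" and p1: "(p has_sum 1) {1..}"
  shows "\<exists>!\<mu>. invariant_prob T G p \<mu>"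
    and "invariant_prob T G p \<mu> \<Longrightarrow> measure_support T \<mu> = {(s, f s) | s. s \<in> I}"
proof -
  have p0': "0 \<le> p i" if "i \<ge> 1" for i using p0[OF that] by simp
  have "\<exists>!\<nu>. invariant_prob euclidean Z p \<nu>"
    by (rule invariant_prob_real_unique[OF Z_lipschitz ratio_less_1 Z_in_I p0' p1])
  then obtain \<nu> where \<nu>: "invariant_prob euclidean Z p \<nu>"
    and \<nu>_unique: "\<And>\<nu>'. invariant_prob euclidean Z p \<nu>' \<Longrightarrow> \<nu>' = \<nu>"
    by blast
  have \<nu>_sets: "sets \<nu> = sets borel" "space \<nu> = UNIV"
    using \<nu> by (auto simp: invariant_prob_def borel_of_top_euclidean)
  define \<mu>\<^sub>0 where "\<mu>\<^sub>0 = distr \<nu> (borel_of_top T) graph_point"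
  have gm: "graph_point \<in> \<nu> \<rightarrow>\<^sub>M borel_of_top T"
    using measurable_borel_of_top[OF continuous_map_graph_point]
    by (simp add: borel_of_top_euclidean measurable_cong_sets[OF \<nu>_sets(1) refl])
  have inv: "invariant_prob T G p \<mu>\<^sub>0"
    unfolding \<mu>\<^sub>0_def
    by (rule invariant_prob_distr[OF \<nu> continuous_map_graph_point])
      (auto simp: graph_point_Z continuous_map_G)
  have unique: "\<mu> = \<mu>\<^sub>0" if \<mu>: "invariant_prob T G p \<mu>" for \<mu>
  proof -
    have sp: "space \<mu> = X" and se: "sets \<mu> = sets (borel_of_top T)"
      using \<mu> by (auto simp: invariant_prob_def)
    have fm: "fst \<in> \<mu> \<rightarrow>\<^sub>M borel"
      using measurable_borel_of_top[OF continuous_map_fst]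
      by (simp add: borel_of_top_euclidean measurable_cong_sets[OF se refl])
    have "invariant_prob euclidean Z p (distr \<mu> (borel_of_top euclidean) fst)"
      using continuous_Z G_in_X fst_G_Z
      by (intro invariant_prob_distr[OF \<mu> continuous_map_fst]) auto
    then have \<nu>_eq: "\<nu> = distr \<mu> borel fst"
      using \<nu>_unique by (simp add: borel_of_top_euclidean)
    have "AE x in \<mu>. gap x = 0"
      using \<alpha> gap_G_le
      by (intro invariant_prob_AE_zero[OF \<mu> continuous_map_G p0' p1 continuous_map_gap gap_nonneg, where c = "\<bar>\<alpha>\<bar>"])
        auto
    then have AE: "AE x in \<mu>. graph_point (fst x) = x"
      using AE_space
    proof eventually_elim
      case (elim x)
      then show ?case using gap_eq_0_iff[of x] by (auto simp: sp graph_point_on_I)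
    qed
    show "\<mu> = \<mu>\<^sub>0"
    proof (rule measure_eqI)
      show "sets \<mu> = sets \<mu>\<^sub>0" by (simp add: \<mu>\<^sub>0_def se)
      fix A assume A: "A \<in> sets \<mu>"
      have gA: "graph_point -` A \<in> sets borel"
        using measurable_sets[OF gm] A by (simp add: se \<nu>_sets)
      \<comment> \<open>On the graph, which carries \<open>\<mu>\<close>, \<open>x\<close> lies in
        \<open>A\<close> exactly when \<open>graph_point (fst x)\<close> does.\<close>
      have "emeasure \<mu>\<^sub>0 A = emeasure \<mu> (fst -` (graph_point -` A) \<inter> space \<mu>)"
        using A by (simp add: \<mu>\<^sub>0_def emeasure_distr[OF gm] se \<nu>_sets) (simp add: \<nu>_eq emeasure_distr[OF fm gA])
      also have "\<dots> = emeasure \<mu> A"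
        using AE A measurable_sets[OF fm gA] sets.sets_into_space[OF A] by (intro emeasure_eq_AE) auto
      finally show "emeasure \<mu> A = emeasure \<mu>\<^sub>0 A" ..
    qed
  qed
  from inv unique show "\<exists>!\<mu>. invariant_prob T G p \<mu>" by blast
  have em: "emeasure \<mu>\<^sub>0 U = emeasure \<nu> (graph_point -` U)" if "openin T U" for U
    using openin_borel_of_top[OF that] by (simp add: \<mu>\<^sub>0_def emeasure_distr[OF gm] \<nu>_sets)
  have supp: "measure_support T \<mu>\<^sub>0 = {(s, f s) | s. s \<in> I}"
  proof (intro equalityI subsetI)
    fix x assume x: "x \<in> measure_support T \<mu>\<^sub>0"
    then have xX: "x \<in> X" by (simp add: measure_support_def)
    \<comment> \<open>The open set of points off the graph has empty preimage under
      \<open>graph_point\<close>, so it is null.\<close>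
    let ?U = "{y \<in> topspace T. gap y \<in> {0<..}}"
    have U: "openin T ?U"
      using continuous_map_gap unfolding continuous_map_def by (auto simp del: greaterThan_iff)
    have "graph_point -` ?U = {}" by (auto simp: gap_graph_point)
    then have "emeasure \<mu>\<^sub>0 ?U = 0" by (simp only: em[OF U] emeasure_empty)
    then have "x \<notin> ?U" using x U unfolding measure_support_def by force
    then have "gap x = 0" using xX gap_nonneg[of x] by simp
    then show "x \<in> {(s, f s) | s. s \<in> I}" using gap_eq_0_iff[OF xX] xX by (cases x) auto
  next
    fix x assume "x \<in> {(s, f s) | s. s \<in> I}"
    then obtain s where s: "s \<in> I" "x = (s, f s)" by blast
    have "0 < emeasure \<mu>\<^sub>0 U" if U: "openin T U" "x \<in> U" for U
    proof -
      \<comment> \<open>A neighbourhood of \<open>(s, f s)\<close> pulls back to an open set around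
        \<open>s\<close>, where full support on \<open>I\<close> applies.\<close>
      have "open (graph_point -` U)"
        using continuous_map_graph_point U(1) by (simp add: continuous_map_def vimage_def)
      then have "0 < measure \<nu> (graph_point -` U)"
        using s U(2) by (intro full_support_real[OF \<nu> p0 p1 s(1)]) (simp_all add: graph_point_on_I)
      then have "emeasure \<nu> (graph_point -` U) \<noteq> 0" by (auto simp: measure_def)
      then show ?thesis by (simp only: em[OF U(1)] zero_less_iff_neq_zero not_False_eq_True)
    qed
    then show "x \<in> measure_support T \<mu>\<^sub>0"
      using s f_KcR by (auto simp: measure_support_def)
  qed
  show "measure_support T \<mu> = {(s, f s) | s. s \<in> I}" if "invariant_prob T G p \<mu>"
    using unique[OF that] supp by simp
qed

end

theorem theorem5p1:
  fixes t :: "nat \<Rightarrow> real" and tinf :: real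
    and \<zeta> :: "nat \<Rightarrow> real \<Rightarrow> real" and a :: "nat \<Rightarrow> real"
    and \<alpha> :: real and p :: "nat \<Rightarrow> real"
    and B \<Phi> \<Phi>\<alpha> :: "real \<Rightarrow> real set"
  assumes t_mono: "strict_mono_on {1..} t" and t_lim: "t \<longlonglongrightarrow> tinf"
    and \<zeta>: "interp_maps t tinf \<zeta> a"
    and \<alpha>: "\<And>i. i \<ge> 1 \<Longrightarrow> max \<bar>\<alpha>\<bar> (a i) < 1"
    and B: "continuous_map (top_of_set {t 1..tinf}) KcR_top B"
    and \<Phi>: "continuous_map (top_of_set {t 1..tinf}) KcR_top \<Phi>"
    and ends: "B (t 1) \<ominus> \<Phi> (t 1) = B tinf \<ominus> \<Phi> tinf"
    and \<Phi>\<alpha>: "is_fractal_fun t tinf \<zeta> \<alpha> \<Phi> B \<Phi>\<alpha>"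
    and p_sum: "(p has_sum 1) {1..}"
    and p_pos: "\<And>i. i \<ge> 1 \<Longrightarrow> 0 < p i \<and> p i < 1"
  shows "(\<exists>!\<mu>. invariant_prob (graph_top t tinf \<Phi>\<alpha>) (ifs_map \<zeta> \<alpha> \<Phi> B) p \<mu>) \<and>
         (\<forall>\<mu>. invariant_prob (graph_top t tinf \<Phi>\<alpha>) (ifs_map \<zeta> \<alpha> \<Phi> B) p \<mu> \<longrightarrow>
              measure_support (graph_top t tinf \<Phi>\<alpha>) \<mu> = {(s, \<Phi>\<alpha> s) | s. s \<in> {t 1..tinf}})"
proof -
  have KcR_values: "h s \<in> KcR" if "continuous_map (top_of_set {t 1..tinf}) KcR_top h" "s \<in> {t 1..tinf}" for h s
    using continuous_map_funspace[OF that(1)] that(2)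
    by (auto simp: Metric_space.topspace_mtopology[OF Metric_space_KcR] Pi_iff)
  have "\<bar>\<alpha>\<bar> < 1" using \<alpha>[of 1] by simp
  then interpret fractal_ifs t tinf \<zeta> a \<alpha> B \<Phi> \<Phi>\<alpha>
    using t_mono t_lim \<zeta> \<Phi>\<alpha> KcR_values[OF B] KcR_values[OF \<Phi>] by unfold_locales
  have "0 < p i" if "i \<ge> 1" for i using p_pos[OF that] by simp
  from unique_invariant_prob[OF this p_sum] show ?thesis by simp
qed

end
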